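(* Let $N\ge2$, $0<g_1<\cdots<g_N$, $f_{ij}=g_i+g_j$ for $i\ne j$. With $$f_{\min}:=\min_{i\ne j}f_{ij}=g_1+g_2,\qquad f_{\max}:=\max_{i\ne j}f_{ij}=g_{N-1}+g_N,$$ one has $$\sigma(A_N(U))\subset\Bigl[\frac1{f_{\max}},\frac1{f_{\min}}\Bigr],\qquad U\in\mathcal T.$$ In particular, $A_N$ is uniformly normally elliptic on the whole closed moment simplex $\mathcal T$ and $$\sup_{U\in\mathcal T}\bigl(\|A_N(U)\|+\|A_N(U)^{-1}\|\bigr)<\infty.$$
   Context: $E=\{v\in\mathbb R^N:\sum_iv_i=0\}$. $B_{ij}(y)=y_if_{ij}$ ($i\ne j$), $B_{ii}(y)=-\sum_{\ell\ne i}f_{i\ell}y_\ell$; $B(y)|_E:E\to E$ is invertible for every $y$ in the closed simplex $\{y\in[0,1]^N:\sum_iy_i=1\}$. $\mathcal T=\operatorname{co}\{(g_i,g_i^2,\dots,g_i^{N-1})^{\sf T}:i=1,\dots,N\}\subset\mathbb R^{N-1}$; $y\mapsto U$, $U_\ell=\sum_ig_i^\ell y_i$ ($\ell=1,\dots,N-1$), is an affine bijection of the closed simplex onto $\mathcal T$ with inverse $y(U)$. $\mathsf L:E\to\mathbb R^{N-1}$, $\mathsf Lv=(\sum_ig_i^\ell v_i)_{\ell=1}^{N-1}$, $A_N(U)=-\mathsf L(B(y(U))|_E)^{-1}\mathsf L^{-1}$ for $U\in\mathcal T$. $\sigma$ denotes the spectrum. Uniform normal ellipticity means that the spectra of the symbols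 $|\xi|^2A_N(U)$, $|\xi|=1$, lie in $\{\operatorname{Re}\mu\ge c\}$ with one $c>0$ for all $U\in\mathcal T$, with the corresponding uniform sectorial resolvent bound: for each $\vartheta\in(0,\pi/2)$ there is $C$ with $\|(\lambda+|\xi|^2A_N(U))^{-1}\|\le C(|\lambda|+|\xi|^2)^{-1}$ for all $U\in\mathcal T$, $\xi\in\mathbb R^d$, and $\lambda\in\mathbb C$ with $\lambda=0$ or $|\arg\lambda|\le\pi-\vartheta$, $(\lambda,\xi)\ne(0,0)$. *)

theory Defs
  imports
    "HOL-Analysis.L2_Norm"
    "Jordan_Normal_Form.Gauss_Jordan_Elimination"
    "Jordan_Normal_Form.Spectral_Radius"
begin

text \<open>
  Vectors of \<open>\<real>\<^sup>k\<close> are elements of \<^term>\<open>carrier_vec k\<close>.  All indices start at \<open>0\<close>, so the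
  parameters \<open>g\<^sub>1, \<dots>, g\<^sub>N\<close> are \<open>g 0, \<dots>, g (N - 1)\<close>, and the moment of order
  \<open>l \<in> {1..N - 1}\<close> sits in component \<open>l - 1\<close>.
\<close>

definition enorm :: "'a::real_normed_vector vec \<Rightarrow> real" where
  "enorm v = L2_set (\<lambda>i. norm (v $ i)) {..<dim_vec v}"

definition opnorm :: "'a::real_normed_field mat \<Rightarrow> real" where
  "opnorm M = Sup {enorm (M *\<^sub>v x) | x. x \<in> carrier_vec (dim_col M) \<and> enorm x \<le> 1}"

text \<open>Unspecified if \<open>M\<close> is singular; each use below also asserts \<^term>\<open>invertible_mat M\<close>.\<close>

definition minv :: "'a::field mat \<Rightarrow> 'a mat" where
  "minv M = the (mat_inverse M)"

text \<open>The analogue of \<open>convex_hull_finite\<close>, for a finite \<open>P \<subseteq> carrier_vec k\<close>.\<close>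

definition vec_convex_hull :: "nat \<Rightarrow> real vec set \<Rightarrow> real vec set" where
  "vec_convex_hull k P =
     {vec k (\<lambda>l. \<Sum>p\<in>P. c p * p $ l) | c. (\<forall>p\<in>P. 0 \<le> c p) \<and> (\<Sum>p\<in>P. c p) = 1}"

definition zero_sum :: "nat \<Rightarrow> real vec set" where
  "zero_sum N = {v \<in> carrier_vec N. (\<Sum>i<N. v $ i) = 0}"

definition closed_simplex :: "nat \<Rightarrow> real vec set" where
  "closed_simplex N =
     {y \<in> carrier_vec N. (\<forall>i<N. 0 \<le> y $ i \<and> y $ i \<le> 1) \<and> (\<Sum>i<N. y $ i) = 1}"

definition Bmat :: "nat \<Rightarrow> (nat \<Rightarrow> nat \<Rightarrow> real) \<Rightarrow> real vec \<Rightarrow> real mat" where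
  "Bmat N f y = mat N N (\<lambda>(i, j).
     if i = j then - (\<Sum>l\<in>{..<N} - {i}. f i l * y $ l) else y $ i * f i j)"

text \<open>
  The single formula \<open>v \<mapsto> (\<Sum>\<^sub>i g\<^sub>i\<^sup>l v\<^sub>i)\<^sub>l\<close> gives both the map \<open>y \<mapsto> U\<close> on the simplex and the
  map \<open>L\<close> on \<^term>\<open>zero_sum N\<close>.
\<close>

definition moments :: "nat \<Rightarrow> (nat \<Rightarrow> real) \<Rightarrow> real vec \<Rightarrow> real vec" where
  "moments N g v = vec (N - 1) (\<lambda>l. \<Sum>i<N. g i ^ Suc l * v $ i)"

definition moment_simplex :: "nat \<Rightarrow> (nat \<Rightarrow> real) \<Rightarrow> real vec set" where
  "moment_simplex N g =
     vec_convex_hull (N - 1) ((\<lambda>i. vec (N - 1) (\<lambda>l. g i ^ Suc l)) ` {..<N})"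

definition y_of :: "nat \<Rightarrow> (nat \<Rightarrow> real) \<Rightarrow> real vec \<Rightarrow> real vec" where
  "y_of N g U = inv_into (closed_simplex N) (moments N g) U"

definition A_op ::
  "nat \<Rightarrow> (nat \<Rightarrow> real) \<Rightarrow> (nat \<Rightarrow> nat \<Rightarrow> real) \<Rightarrow> real vec \<Rightarrow> real vec \<Rightarrow> real vec" where
  "A_op N g f U w =
     - moments N g
         (inv_into (zero_sum N) (\<lambda>v. Bmat N f (y_of N g U) *\<^sub>v v)
           (inv_into (zero_sum N) (moments N g) w))"

definition A_mat ::
  "nat \<Rightarrow> (nat \<Rightarrow> real) \<Rightarrow> (nat \<Rightarrow> nat \<Rightarrow> real) \<Rightarrow> real vec \<Rightarrow> real mat" where
  "A_mat N g f U =
     mat (N - 1) (N - 1) (\<lambda>(i, j). A_op N g f U (unit_vec (N - 1) j) $ i)"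

abbreviation cmat :: "real mat \<Rightarrow> complex mat" where
  "cmat \<equiv> map_mat complex_of_real"

abbreviation cspectrum :: "real mat \<Rightarrow> complex set" where
  "cspectrum M \<equiv> spectrum (cmat M)"

text \<open>
  \<open>d\<close> is the dimension of the frequency variable \<open>\<xi>\<close>, and \<open>A U\<close> is a \<open>k \<times> k\<close> matrix for \<open>U \<in> T\<close>.
\<close>

definition uniformly_normally_elliptic ::
  "nat \<Rightarrow> nat \<Rightarrow> real vec set \<Rightarrow> (real vec \<Rightarrow> real mat) \<Rightarrow> bool" where
  "uniformly_normally_elliptic d k T A \<longleftrightarrow>
     (\<exists>c>0. \<forall>U\<in>T. \<forall>\<xi>\<in>(carrier_vec d :: real vec set). enorm \<xi> = 1 \<longrightarrow>
        cspectrum ((enorm \<xi>)\<^sup>2 \<cdot>\<^sub>m A U) \<subseteq> {\<mu>. c \<le> Re \<mu>}) \<and>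
     (\<forall>\<theta>. 0 < \<theta> \<and> \<theta> < pi / 2 \<longrightarrow>
       (\<exists>C. \<forall>U\<in>T. \<forall>\<xi>\<in>(carrier_vec d :: real vec set). \<forall>z::complex.
          (z = 0 \<or> \<bar>Arg z\<bar> \<le> pi - \<theta>) \<and> (z \<noteq> 0 \<or> \<xi> \<noteq> 0\<^sub>v d) \<longrightarrow>
          (let M = z \<cdot>\<^sub>m 1\<^sub>m k + cmat ((enorm \<xi>)\<^sup>2 \<cdot>\<^sub>m A U)
           in invertible_mat M \<and> opnorm (minv M) \<le> C / (cmod z + (enorm \<xi>)\<^sup>2))))"

end

theory Submission
  imports Defs
begin

text \<open>
  With \<open>m = \<Sum>i. g\<^sub>i y\<^sub>i\<close> and \<open>a\<^sub>i = g\<^sub>i + m\<close>, on zero-sum vectors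
  \<open>(-B v)\<^sub>i = a\<^sub>i v\<^sub>i - y\<^sub>i \<Sum>j. g\<^sub>j v\<^sub>j\<close>, and \<open>A(U)\<close> is conjugate by \<open>L\<close> to \<open>(-B)\<inverse>\<close>.
  An eigenvalue \<open>\<lambda>\<close> of \<open>-B\<close> is either some \<open>a\<^sub>i\<close> with \<open>y\<^sub>i = 0\<close>, which is an average of the numbers
  \<open>f\<^sub>i\<^sub>j\<close>, or has an eigenvector \<open>v\<^sub>i = y\<^sub>i h\<^sub>i\<close> with \<open>h\<^sub>i = 1 / (a\<^sub>i - \<lambda>)\<close>; then \<open>\<lambda>\<close> is the quotient of
  \<open>\<Sum>i<j. f\<^sub>i\<^sub>j y\<^sub>i y\<^sub>j \<bar>h\<^sub>i - h\<^sub>j\<bar>\<^sup>2\<close> by the same sum without \<open>f\<^sub>i\<^sub>j\<close>.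
  The resolvent equation \<open>z (-B) v + r v = w\<close> is solved explicitly, with constants that depend
  only on \<open>g\<close> and the sector, so no compactness argument in \<open>U\<close> is needed.
\<close>

section \<open>Moments\<close>

definition mom :: "(nat \<Rightarrow> real) \<Rightarrow> nat \<Rightarrow> (nat \<Rightarrow> 'a::real_normed_field) \<Rightarrow> nat \<Rightarrow> 'a" where
  "mom g N v l = (\<Sum>i<N. of_real (g i) ^ Suc l * v i)"

text \<open>The rows of \<open>c\<close> are the coefficients of the Lagrange polynomials of the nodes \<open>g i\<close>.\<close>

lemma vandermonde_inverse:
  fixes g :: "nat \<Rightarrow> real"
  assumes inj: "inj_on g {..<N}"
  obtains c :: "nat \<Rightarrow> nat \<Rightarrow> real" where
    "\<And>i j. i < N \<Longrightarrow> j < N \<Longrightarrow> (\<Sum>l<N. c i l * g j ^ l) = (if i = j then 1 else 0)"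
    "\<And>k l. k < N \<Longrightarrow> l < N \<Longrightarrow> (\<Sum>i<N. g i ^ k * c i l) = (if k = l then 1 else 0)"
proof -
  define Q where "Q i = (\<Prod>j\<in>{..<N} - {i}. [:- g j, 1:])" for i
  define c where "c i l = coeff (Q i) l / poly (Q i) (g i)" for i l
  have deg: "degree (Q i) < N" if "i < N" for i
  proof -
    have "degree (Q i) \<le> sum (degree \<circ> (\<lambda>j. [:- g j, 1:])) ({..<N} - {i})"
      unfolding Q_def by (rule degree_prod_sum_le) simp
    also have "\<dots> = N - 1" using that by simp
    finally show ?thesis using that by simp
  qed
  have poly_Q: "poly (Q i) x = (\<Sum>l<N. coeff (Q i) l * x ^ l)" if "i < N" for i x
    unfolding poly_altdef using deg[OF that]
    by (intro sum.mono_neutral_left) (auto simp: coeff_eq_0)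
  have Q_zero: "poly (Q i) (g j) = 0" if "j < N" "i \<noteq> j" for i j
    unfolding Q_def poly_prod using that by (intro prod_zero) auto
  have Q_nonzero: "poly (Q i) (g i) \<noteq> 0" if "i < N" for i
    unfolding Q_def poly_prod using that inj by (auto simp: inj_on_def)
  have one: "(\<Sum>l<N. c i l * g j ^ l) = (if i = j then 1 else 0)" if "i < N" "j < N" for i j
  proof -
    have "(\<Sum>l<N. c i l * g j ^ l) = poly (Q i) (g j) / poly (Q i) (g i)"
      unfolding c_def poly_Q[OF that(1)] by (simp add: sum_divide_distrib)
    then show ?thesis using that Q_zero Q_nonzero by auto
  qed
  define X where "X = mat N N (\<lambda>(i, l). c i l)"
  define V where "V = mat N N (\<lambda>(l, j). g j ^ l)"
  have X: "X \<in> carrier_mat N N" and V: "V \<in> carrier_mat N N" by (auto simp: X_def V_def)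
  \<comment> \<open>The Lagrange property makes \<open>X\<close> a left inverse of the Vandermonde
    matrix \<open>V\<close>; for square matrices it is then a right inverse, which is the second
    relation.\<close>
  have "X * V = 1\<^sub>m N"
    by (rule eq_matI) (auto simp: X_def V_def scalar_prod_def one lessThan_atLeast0[symmetric])
  then have VX: "V * X = 1\<^sub>m N" by (rule mat_mult_left_right_inverse[OF X V])
  have two: "(\<Sum>i<N. g i ^ k * c i l) = (if k = l then 1 else 0)" if "k < N" "l < N" for k l
  proof -
    have "(V * X) $$ (k, l) = (\<Sum>i<N. g i ^ k * c i l)"
      using that by (simp add: X_def V_def scalar_prod_def lessThan_atLeast0[symmetric])
    then show ?thesis using VX that by simp
  qed
  show ?thesis using that one two by blast
qed

text \<open>Since \<open>mom\<close> starts at exponent 1, the vanishing sum supplies the moment of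
  order 0. All \<open>N\<close> moments are then prescribed, and the inverse Vandermonde matrix
  solves for \<open>v\<close>.\<close>

lemma mom_surj:
  fixes w :: "nat \<Rightarrow> 'a::real_normed_field"
  assumes "inj_on g {..<N}" "0 < N"
  obtains v where "(\<Sum>i<N. v i) = 0" "\<And>l. l < N - 1 \<Longrightarrow> mom g N v l = w l"
proof -
  obtain c where c: "\<And>k l. k < N \<Longrightarrow> l < N \<Longrightarrow> (\<Sum>i<N. g i ^ k * c i l) = (if k = l then 1 else 0)"
    using vandermonde_inverse[OF assms(1)] by metis
  define v where "v i = (\<Sum>l<N - 1. of_real (c i (Suc l)) * w l)" for i
  have key: "(\<Sum>i<N. of_real (g i) ^ k * v i) = (\<Sum>l<N - 1. of_real (if k = Suc l then 1 else 0) * w l)"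
    if "k < N" for k
  proof -
    have "(\<Sum>i<N. of_real (g i) ^ k * v i)
        = (\<Sum>i<N. \<Sum>l<N - 1. of_real (g i ^ k * c i (Suc l)) * w l)"
      by (simp add: v_def sum_distrib_left mult_ac)
    also have "\<dots> = (\<Sum>l<N - 1. of_real (\<Sum>i<N. g i ^ k * c i (Suc l)) * w l)"
      by (subst sum.swap) (simp add: sum_distrib_right)
    also have "\<dots> = (\<Sum>l<N - 1. of_real (if k = Suc l then 1 else 0) * w l)"
      using that by (intro sum.cong refl, subst c) auto
    finally show ?thesis .
  qed
  show ?thesis
  proof
    show "(\<Sum>i<N. v i) = 0" using key[of 0] assms(2) by simp
    show "mom g N v l = w l" if "l < N - 1" for l
    proof -
      have "mom g N v l = (\<Sum>k<N - 1. of_real (if Suc l = Suc k then 1 else 0) * w k)"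
        unfolding mom_def using that by (intro key) simp
      also have "\<dots> = (\<Sum>k<N - 1. if l = k then w k else 0)"
        by (intro sum.cong) auto
      finally have "mom g N v l = (\<Sum>k<N - 1. if l = k then w k else 0)" .
      then show ?thesis using that by simp
    qed
  qed
qed

text \<open>Lagrange coefficients recover \<open>v\<close> linearly from its moments of order 0 to
  \<open>N - 1\<close>, and the one of order 0 vanishes. The constant collects the remaining
  coefficients, so it depends on the nodes alone.\<close>

lemma mom_bounded_below:
  assumes "inj_on g {..<N}"
  obtains C :: real where "0 \<le> C"
    "\<And>v :: nat \<Rightarrow> 'a::real_normed_field. (\<Sum>i<N. v i) = 0 \<Longrightarrow>
       (\<Sum>i<N. norm (v i)) \<le> C * (\<Sum>l<N - 1. norm (mom g N v l))"
proof (cases "N = 0")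
  case True
  then show ?thesis using that[of 0] by simp
next
  case False
  then obtain n where N: "N = Suc n" by (cases N) auto
  then have n: "N - Suc 0 = n" by simp
  obtain c where c: "\<And>i j. i < N \<Longrightarrow> j < N \<Longrightarrow> (\<Sum>l<N. c i l * g j ^ l) = (if i = j then 1 else 0)"
    using vandermonde_inverse[OF assms(1)] by metis
  define C where "C = (\<Sum>i<N. \<Sum>l<n. \<bar>c i (Suc l)\<bar>)"
  show ?thesis
  proof
    show "0 \<le> C" by (simp add: C_def sum_nonneg)
    fix v :: "nat \<Rightarrow> 'a"
    assume v0: "(\<Sum>i<N. v i) = 0"
    define S where "S = (\<Sum>l<n. norm (mom g N v l))"
    have v: "v i = (\<Sum>l<n. of_real (c i (Suc l)) * mom g N v l)" if "i < N" for i
    proof -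
      have "v i = (\<Sum>j<N. of_real (if i = j then 1 else 0) * v j)"
        using that by (simp add: of_real_def if_distrib if_distribR cong: if_cong)
      also have "\<dots> = (\<Sum>j<N. of_real (\<Sum>l<N. c i l * g j ^ l) * v j)"
        using that by (intro sum.cong refl, subst c) auto
      also have "\<dots> = (\<Sum>l<N. of_real (c i l) * (\<Sum>j<N. of_real (g j) ^ l * v j))"
        by (simp add: sum_distrib_left sum_distrib_right mult_ac) (rule sum.swap)
      \<comment> \<open>The term with exponent 0 is \<open>c i 0\<close> times the vanishing sum of
        \<open>v\<close>.\<close>
      also have "\<dots> = (\<Sum>l<n. of_real (c i (Suc l)) * mom g N v l)"
        unfolding mom_def using v0 by (subst (1) N) (simp add: sum.lessThan_Suc_shift del: sum.lessThan_Suc power_Suc)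
      finally show ?thesis .
    qed
    have "norm (v i) \<le> (\<Sum>l<n. \<bar>c i (Suc l)\<bar>) * S" if "i < N" for i
    proof -
      have "norm (v i) \<le> (\<Sum>l<n. \<bar>c i (Suc l)\<bar> * norm (mom g N v l))"
        unfolding v[OF that] by (rule order_trans[OF norm_sum]) (simp add: norm_mult)
      also have "\<dots> \<le> (\<Sum>l<n. \<bar>c i (Suc l)\<bar> * S)"
        unfolding S_def by (intro sum_mono mult_left_mono member_le_sum) auto
      finally show ?thesis by (simp add: sum_distrib_right)
    qed
    then have "(\<Sum>i<N. norm (v i)) \<le> (\<Sum>i<N. (\<Sum>l<n. \<bar>c i (Suc l)\<bar>) * S)"
      by (intro sum_mono) auto
    then show "(\<Sum>i<N. norm (v i)) \<le> C * (\<Sum>l<N - 1. norm (mom g N v l))"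
      by (simp add: C_def S_def n sum_distrib_right)
  qed
qed

lemma mom_bounded:
  obtains C :: real where "0 \<le> C"
    "\<And>v :: nat \<Rightarrow> 'a::real_normed_field.
       (\<Sum>l<N - 1. norm (mom g N v l)) \<le> C * (\<Sum>i<N. norm (v i))"
proof
  define C where "C = (\<Sum>l<N - 1. \<Sum>i<N. \<bar>g i\<bar> ^ Suc l)"
  show "0 \<le> C" by (simp add: C_def sum_nonneg)
  fix v :: "nat \<Rightarrow> 'a"
  have "norm (mom g N v l) \<le> (\<Sum>i<N. \<bar>g i\<bar> ^ Suc l) * (\<Sum>i<N. norm (v i))" for l
  proof -
    have "norm (mom g N v l) \<le> (\<Sum>i<N. \<bar>g i\<bar> ^ Suc l * norm (v i))"
      unfolding mom_def
      by (rule order_trans[OF norm_sum]) (simp add: norm_mult norm_power del: power_Suc)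
    also have "\<dots> \<le> (\<Sum>i<N. \<bar>g i\<bar> ^ Suc l * (\<Sum>i<N. norm (v i)))"
      by (intro sum_mono mult_left_mono member_le_sum) auto
    finally show ?thesis by (simp add: sum_distrib_right)
  qed
  then have "(\<Sum>l<N - 1. norm (mom g N v l)) \<le> (\<Sum>l<N - 1. (\<Sum>i<N. \<bar>g i\<bar> ^ Suc l) * (\<Sum>i<N. norm (v i)))"
    by (intro sum_mono)
  then show "(\<Sum>l<N - 1. norm (mom g N v l)) \<le> C * (\<Sum>i<N. norm (v i))"
    by (simp add: C_def sum_distrib_right)
qed

section \<open>The operator on the zero-sum space\<close>

text \<open>
  Agrees with \<open>-B\<close> on zero-sum vectors only: the terms \<open>2 g\<^sub>i y\<^sub>i v\<^sub>i\<close> missing from the diagonal and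
  off-diagonal sums of \<open>B\<close> cancel each other.
\<close>

definition negB :: "(nat \<Rightarrow> real) \<Rightarrow> nat \<Rightarrow> (nat \<Rightarrow> real) \<Rightarrow> (nat \<Rightarrow> 'a::real_normed_field) \<Rightarrow> nat \<Rightarrow> 'a" where
  "negB g N y v i =
     of_real (g i + (\<Sum>j<N. g j * y j)) * v i - of_real (y i) * (\<Sum>j<N. of_real (g j) * v j)"

text \<open>The diagonal part contributes \<open>G\<close>, and the rank-one part removes it again
  because \<open>y\<close> has total mass 1. Thus the zero-sum space is invariant.\<close>

lemma sum_negB:
  fixes v :: "nat \<Rightarrow> 'a::real_normed_field"
  assumes y: "(\<Sum>i<N. y i) = 1" and v: "(\<Sum>i<N. v i) = 0"
  shows "(\<Sum>i<N. negB g N y v i) = 0"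
proof -
  define m where "m = (\<Sum>j<N. g j * y j)"
  define G where "G = (\<Sum>j<N. of_real (g j) * v j)"
  have "(\<Sum>i<N. negB g N y v i) = G + of_real m * (\<Sum>i<N. v i) - of_real (\<Sum>i<N. y i) * G"
    by (simp add: negB_def m_def[symmetric] G_def[symmetric] sum_subtractf sum.distrib
        distrib_right sum_distrib_left sum_distrib_right)
  then show ?thesis by (simp only: y v) simp
qed

text \<open>\<open>negB\<close> is a diagonal operator minus a rank-one term. Treating the scalar
  \<open>G\<close> as an unknown decouples the equations; the zero-sum condition then determines
  \<open>G\<close>.\<close>

lemma negB_surj:
  fixes w :: "nat \<Rightarrow> 'a::real_normed_field"
  assumes y: "\<And>i. i < N \<Longrightarrow> 0 \<le> y i" "(\<Sum>i<N. y i) = 1"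
    and pos: "\<And>i. i < N \<Longrightarrow> 0 < g i + (\<Sum>j<N. g j * y j)"
    and w: "(\<Sum>i<N. w i) = 0"
  obtains v where "(\<Sum>i<N. v i) = 0" "\<And>i. i < N \<Longrightarrow> negB g N y v i = w i"
proof -
  define m where "m = (\<Sum>j<N. g j * y j)"
  define a where "a i = g i + m" for i
  have a: "0 < a i" if "i < N" for i using pos[OF that] by (simp add: a_def m_def)
  define S where "S = (\<Sum>i<N. y i / a i)"
  have S: "S \<noteq> 0"
  proof
    assume "S = 0"
    moreover have "\<forall>i\<in>{..<N}. 0 \<le> y i / a i" using y(1) a by (auto intro!: divide_nonneg_pos)
    ultimately have "\<forall>i\<in>{..<N}. y i / a i = 0"
      unfolding S_def by (subst (asm) sum_nonneg_eq_0_iff) auto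
    then have "(\<Sum>i<N. y i) = 0" using a by (intro sum.neutral) force
    then show False using y(2) by simp
  qed
  define G where "G = - (\<Sum>i<N. w i / of_real (a i)) / of_real S"
  define v where "v i = (w i + of_real (y i) * G) / of_real (a i)" for i
  have av: "of_real (a i) * v i = w i + of_real (y i) * G" if "i < N" for i
    using a[OF that] by (simp add: v_def)
  have "(\<Sum>i<N. v i) = (\<Sum>i<N. w i / of_real (a i)) + of_real S * G"
    by (simp add: v_def S_def add_divide_distrib sum.distrib sum_distrib_right)
  then have v0: "(\<Sum>i<N. v i) = 0" using S by (simp add: G_def)
  \<comment> \<open>Consistency: by \<open>g i = a i - m\<close>, the value chosen for
    \<open>G\<close> is indeed the weighted sum occurring in \<open>negB\<close>.\<close>
  have "(\<Sum>i<N. of_real (g i) * v i) = (\<Sum>i<N. of_real (a i) * v i) - of_real m * (\<Sum>i<N. v i)"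
    by (simp add: a_def distrib_right sum.distrib sum_distrib_left)
  also have "\<dots> = (\<Sum>i<N. w i + of_real (y i) * G)"
    using v0 by (simp add: av cong: sum.cong_simp)
  also have "\<dots> = (\<Sum>i<N. w i) + of_real (\<Sum>i<N. y i) * G"
    by (simp add: sum.distrib sum_distrib_right)
  also have "\<dots> = G" by (simp only: w y) simp
  finally have G: "(\<Sum>i<N. of_real (g i) * v i) = G" .
  have "negB g N y v i = w i" if "i < N" for i
    unfolding negB_def G using av[OF that] by (simp add: a_def m_def)
  with v0 show ?thesis using that by blast
qed

text \<open>The factor 3 counts \<open>g i\<close>, the mean \<open>m\<close> and the rank-one term,
  each contributing at most \<open>b\<close>; the constant is uniform in \<open>y\<close>.\<close>

lemma negB_bounded:
  fixes v :: "nat \<Rightarrow> 'a::real_normed_field"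
  assumes y: "\<And>i. i < N \<Longrightarrow> 0 \<le> y i" "(\<Sum>i<N. y i) = 1"
    and g: "\<And>i. i < N \<Longrightarrow> 0 \<le> g i \<and> g i \<le> b"
  shows "(\<Sum>i<N. norm (negB g N y v i)) \<le> 3 * b * (\<Sum>i<N. norm (v i))"
proof -
  define m where "m = (\<Sum>j<N. g j * y j)"
  define V where "V = (\<Sum>i<N. norm (v i))"
  have "m \<le> (\<Sum>j<N. b * y j)" unfolding m_def using y g by (intro sum_mono mult_right_mono) auto
  also have "\<dots> = b" using y by (simp add: sum_distrib_left[symmetric])
  finally have m: "m \<le> b" .
  have m0: "0 \<le> m" unfolding m_def using y g by (intro sum_nonneg mult_nonneg_nonneg) auto
  have G: "norm (\<Sum>j<N. of_real (g j) * v j) \<le> b * V"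
  proof -
    have "norm (\<Sum>j<N. of_real (g j) * v j) \<le> (\<Sum>j<N. \<bar>g j\<bar> * norm (v j))"
      by (rule order_trans[OF norm_sum]) (simp add: norm_mult)
    also have "\<dots> \<le> (\<Sum>j<N. b * norm (v j))" using g by (intro sum_mono mult_right_mono) auto
    finally show ?thesis by (simp add: V_def sum_distrib_left)
  qed
  have "norm (negB g N y v i) \<le> 2 * b * norm (v i) + y i * (b * V)" if i: "i < N" for i
  proof -
    have "norm (negB g N y v i)
        \<le> norm (of_real (g i + m) * v i) + norm (of_real (y i) * (\<Sum>j<N. of_real (g j) * v j))"
      unfolding negB_def m_def by (rule norm_triangle_ineq4)
    also have "norm (of_real (g i + m) * v i) = (g i + m) * norm (v i)"
      using g[OF i] m0 by (simp add: norm_mult flip: of_real_add)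
    also have "\<dots> \<le> 2 * b * norm (v i)" using g[OF i] m by (intro mult_right_mono) auto
    also have "norm (of_real (y i) * (\<Sum>j<N. of_real (g j) * v j)) \<le> y i * (b * V)"
      using y(1)[OF i] G by (simp add: norm_mult mult_left_mono)
    finally show ?thesis by simp
  qed
  then have "(\<Sum>i<N. norm (negB g N y v i)) \<le> (\<Sum>i<N. 2 * b * norm (v i) + y i * (b * V))"
    by (intro sum_mono) auto
  also have "\<dots> = 2 * b * V + (\<Sum>i<N. y i) * (b * V)"
    by (simp add: sum.distrib V_def flip: sum_distrib_left sum_distrib_right)
  finally show ?thesis by (simp only: y V_def mult_1)
qed

text \<open>
  Solving \<open>z (-B) v + r v = w\<close> leaves the scalar \<open>\<Sum>i. y i / (z a\<^sub>i + r)\<close> to be inverted.  All its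
  terms lie in a cone of opening less than \<open>\<pi>\<close> with bisector \<open>e\<close>, so they cannot cancel.
\<close>

lemma negB_resolvent_bound:
  fixes v :: "nat \<Rightarrow> complex" and z e :: complex
  assumes y: "\<And>i. i < N \<Longrightarrow> 0 \<le> y i" "(\<Sum>i<N. y i) = 1"
    and a: "\<And>i. i < N \<Longrightarrow> \<alpha> \<le> g i + (\<Sum>j<N. g j * y j) \<and> g i + (\<Sum>j<N. g j * y j) \<le> \<beta>"
    and \<alpha>: "0 < \<alpha>" "\<alpha> \<le> 1" and \<beta>: "1 \<le> \<beta>"
    and e: "cmod e = 1" "s * cmod z \<le> Re (e * z)" "s \<le> Re e" and s: "0 < s"
    and r: "0 \<le> r" "0 < cmod z + r"
    and v: "(\<Sum>i<N. v i) = 0"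
  shows "(\<Sum>i<N. cmod (v i)) \<le> ((1 + \<beta> / (\<alpha> * s * s)) / (\<alpha> * s)) / (cmod z + r) *
           (\<Sum>i<N. cmod (z * negB g N y v i + of_real r * v i))"
proof -
  define m where "m = (\<Sum>j<N. g j * y j)"
  define A where "A i = g i + m" for i
  define G where "G = (\<Sum>j<N. of_real (g j) * v j)"
  define w where "w i = z * negB g N y v i + of_real r * v i" for i
  define W where "W = (\<Sum>i<N. cmod (w i))"
  define q where "q i = z * of_real (A i) + of_real r" for i
  define R where "R = cmod z + r"
  \<comment> \<open>\<open>p i\<close> is \<open>q i\<close> with \<open>z\<close> replaced by its
    modulus. It is comparable to \<open>R\<close> uniformly in \<open>y\<close>, and the sector
    condition makes \<open>q i\<close> smaller by at most the factor \<open>s\<close>.\<close>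
  define p where "p i = cmod z * A i + r" for i
  have R: "0 < R" using r by (simp add: R_def)
  have A: "\<alpha> \<le> A i" "A i \<le> \<beta>" if "i < N" for i using a[OF that] by (auto simp: A_def m_def)
  have p: "\<alpha> * R \<le> p i" "p i \<le> \<beta> * R" if "i < N" for i
  proof -
    have "cmod z * \<alpha> \<le> cmod z * A i" "\<alpha> * r \<le> 1 * r"
      using A[OF that] \<alpha> r by (intro mult_left_mono mult_right_mono; simp)+
    then show "\<alpha> * R \<le> p i" by (simp add: R_def p_def algebra_simps)
    have "cmod z * A i \<le> cmod z * \<beta>" "1 * r \<le> \<beta> * r"
      using A[OF that] \<beta> r by (intro mult_left_mono mult_right_mono; simp)+
    then show "p i \<le> \<beta> * R" by (simp add: R_def p_def algebra_simps)
  qed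
  have p_pos: "0 < p i" if "i < N" for i
    using p(1)[OF that] R \<alpha> by (smt (verit) mult_pos_pos)
  \<comment> \<open>Multiplication by \<open>e\<close> moves both \<open>z\<close> and the positive
    real axis to directions in which the real part controls the modulus.\<close>
  have Re_q: "s * p i \<le> Re (e * q i)" if "i < N" for i
  proof -
    have "s * cmod z * A i \<le> Re (e * z) * A i" "s * r \<le> Re e * r"
      using A[OF that] \<alpha> e r by (intro mult_right_mono; simp)+
    moreover have "Re (e * q i) = Re (e * z) * A i + Re e * r"
      by (simp add: q_def algebra_simps)
    ultimately show ?thesis by (simp add: p_def algebra_simps)
  qed
  have q_lower: "s * p i \<le> cmod (q i)" if "i < N" for i
    using Re_q[OF that] complex_Re_le_cmod[of "e * q i"] by (simp add: norm_mult e)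
  have q_upper: "cmod (q i) \<le> p i" if "i < N" for i
  proof -
    have "cmod (q i) \<le> cmod (z * of_real (A i)) + cmod (of_real r)"
      unfolding q_def by (rule norm_triangle_ineq)
    then show ?thesis using A[OF that] \<alpha> r by (simp add: norm_mult p_def)
  qed
  have q_lower': "\<alpha> * s * R \<le> cmod (q i)" if "i < N" for i
  proof -
    have "s * (\<alpha> * R) \<le> s * p i" using p(1)[OF that] s by (intro mult_left_mono) auto
    with q_lower[OF that] show ?thesis by (simp add: mult_ac)
  qed
  have asR: "0 < \<alpha> * s * R" using \<alpha> s R by simp
  have q0: "q i \<noteq> 0" if "i < N" for i using q_lower'[OF that] asR by auto
  have qv: "q i * v i = w i + of_real (y i) * (z * G)" for i
    by (simp add: q_def w_def negB_def A_def m_def G_def algebra_simps)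
  then have v_eq: "v i = w i / q i + of_real (y i) / q i * (z * G)" if "i < N" for i
    using q0[OF that] by (simp add: field_simps)
  define \<phi> where "\<phi> = (\<Sum>i<N. of_real (y i) / q i)"
  \<comment> \<open>Summing \<open>v_eq\<close> leaves one scalar equation. Keeping the product
    \<open>z * G\<close> as the unknown covers \<open>z = 0\<close> as well.\<close>
  have "0 = (\<Sum>i<N. w i / q i) + \<phi> * (z * G)"
    using v by (simp add: v_eq sum.distrib \<phi>_def sum_distrib_right cong: sum.cong_simp)
  then have zG: "\<phi> * (z * G) = - (\<Sum>i<N. w i / q i)" by (simp add: eq_neg_iff_add_eq_0 add.commute)
  have wq: "cmod (w i / q i) \<le> cmod (w i) / (\<alpha> * s * R)" if "i < N" for i
    using q_lower'[OF that] asR by (simp add: norm_divide frac_le)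
  have \<phi>: "s / (\<beta> * R) \<le> cmod \<phi>"
  proof -
    \<comment> \<open>Since \<open>1 / q i\<close> points in the direction of
      \<open>cnj (q i)\<close>, the factor \<open>cnj e\<close> gives all terms a positive lower
      bound on the real part, and these bounds add up.\<close>
    have "s / (\<beta> * R) * y i \<le> Re (cnj e * (of_real (y i) / q i))" if i: "i < N" for i
    proof -
      have eq: "cnj e * (of_real (y i) / q i) = of_real (y i / (cmod (q i))\<^sup>2) * cnj (e * q i)"
        using q0[OF i] complex_norm_square[of "q i"] by (simp add: field_simps power2_eq_square)
      have "s / (\<beta> * R) \<le> s / p i"
        using p(2)[OF i] p_pos[OF i] s by (intro divide_left_mono) (auto intro: mult_pos_pos order_less_le_trans)
      also have "\<dots> = s * p i / (p i)\<^sup>2" using p_pos[OF i] by (simp add: power2_eq_square)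
      also have "\<dots> \<le> s * p i / (cmod (q i))\<^sup>2"
        using q0[OF i] q_upper[OF i] p_pos[OF i] s
        by (intro divide_left_mono power_mono mult_pos_pos) auto
      also have "\<dots> \<le> Re (e * q i) / (cmod (q i))\<^sup>2"
        using Re_q[OF i] by (intro divide_right_mono) auto
      finally have "s / (\<beta> * R) * y i \<le> Re (e * q i) / (cmod (q i))\<^sup>2 * y i"
        using y(1)[OF i] by (intro mult_right_mono) auto
      also have "\<dots> = Re (of_real (y i / (cmod (q i))\<^sup>2) * cnj (e * q i))"
        by (simp add: Re_complex_of_real Im_complex_of_real del: of_real_divide complex_cnj_mult)
      finally show ?thesis unfolding eq .
    qed
    then have "(\<Sum>i<N. s / (\<beta> * R) * y i) \<le> (\<Sum>i<N. Re (cnj e * (of_real (y i) / q i)))"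
      by (intro sum_mono) auto
    also have "\<dots> = Re (cnj e * \<phi>)" by (simp add: \<phi>_def sum_distrib_left)
    also have "\<dots> \<le> cmod (cnj e * \<phi>)" by (rule complex_Re_le_cmod)
    also have "\<dots> = cmod \<phi>" by (simp add: norm_mult e)
    finally show ?thesis by (simp only: y mult_1_right flip: sum_distrib_left)
  qed
  have zG_bound: "cmod (z * G) \<le> \<beta> / (\<alpha> * s * s) * W"
  proof -
    have "s / (\<beta> * R) * cmod (z * G) \<le> cmod (\<phi> * (z * G))"
      using \<phi> by (subst norm_mult) (intro mult_right_mono, auto)
    also have "\<dots> \<le> (\<Sum>i<N. cmod (w i / q i))" by (simp only: zG norm_minus_cancel norm_sum)
    also have "\<dots> \<le> (\<Sum>i<N. cmod (w i) / (\<alpha> * s * R))" using wq by (intro sum_mono) auto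
    also have "\<dots> = W / (\<alpha> * s * R)" by (simp add: W_def sum_divide_distrib)
    finally show ?thesis using s R \<beta> \<alpha> by (simp add: field_simps)
  qed
  have "cmod (v i) \<le> (cmod (w i) + y i * cmod (z * G)) / (\<alpha> * s * R)" if i: "i < N" for i
  proof -
    have "v i = (w i + of_real (y i) * (z * G)) / q i" using qv[of i] q0[OF i] by (simp add: field_simps)
    then have "cmod (v i) = cmod (w i + of_real (y i) * (z * G)) / cmod (q i)"
      by (simp add: norm_divide)
    also have "\<dots> \<le> (cmod (w i) + y i * cmod (z * G)) / (\<alpha> * s * R)"
      using q_lower'[OF i] asR y(1)[OF i]
      by (intro frac_le) (auto intro!: norm_triangle_le simp: norm_mult)
    finally show ?thesis .
  qed
  then have "(\<Sum>i<N. cmod (v i)) \<le> (\<Sum>i<N. (cmod (w i) + y i * cmod (z * G)) / (\<alpha> * s * R))"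
    by (intro sum_mono) auto
  also have "\<dots> = (W + cmod (z * G)) / (\<alpha> * s * R)"
    using y(2) by (simp add: W_def sum.distrib sum_divide_distrib[symmetric] flip: sum_distrib_right)
  also have "\<dots> \<le> (W + \<beta> / (\<alpha> * s * s) * W) / (\<alpha> * s * R)"
    using zG_bound asR by (intro divide_right_mono) auto
  also have "\<dots> = ((1 + \<beta> / (\<alpha> * s * s)) / (\<alpha> * s)) / R * W"
    by (simp add: algebra_simps add_divide_distrib)
  finally show ?thesis by (simp add: W_def w_def R_def)
qed

section \<open>Location of the spectrum on the zero-sum space\<close>

text \<open>The double sum of \<open>y i * y j * (g i + g j - lo) * (h i - h j)\<^sup>2\<close> is
  nonnegative and expands to twice the right side minus the left side, the mixed terms vanishing by
  \<open>h\<close>. Pairs \<open>i = j\<close> contribute 0, so only sums over distinct indices have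
  to be bounded.\<close>

lemma weighted_variance_lower_bound:
  fixes h :: "nat \<Rightarrow> real"
  assumes y: "\<And>i. i < N \<Longrightarrow> 0 \<le> y i" "(\<Sum>i<N. y i) = 1"
    and h: "(\<Sum>i<N. y i * h i) = 0"
    and lo: "\<And>i j. i < N \<Longrightarrow> j < N \<Longrightarrow> i \<noteq> j \<Longrightarrow> lo \<le> g i + g j"
  shows "lo * (\<Sum>i<N. y i * (h i)\<^sup>2) \<le> (\<Sum>i<N. y i * (g i + (\<Sum>j<N. g j * y j)) * (h i)\<^sup>2)"
proof -
  define m where "m = (\<Sum>j<N. g j * y j)"
  define S where "S = (\<Sum>i<N. y i * (h i)\<^sup>2)"
  define T where "T = (\<Sum>i<N. g i * y i * (h i)\<^sup>2)"
  define H where "H = (\<Sum>i<N. g i * y i * h i)"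
  have "0 \<le> (\<Sum>i<N. \<Sum>j<N. y i * y j * (g i + g j - lo) * (h i - h j)\<^sup>2)"
    using y(1) lo by (intro sum_nonneg) (case_tac "x = xa"; auto intro!: mult_nonneg_nonneg)
  also have "\<dots> = (\<Sum>i<N. \<Sum>j<N.
      (g i * y i * (h i)\<^sup>2) * y j + y i * (g j * y j * (h j)\<^sup>2) + (g i * y i) * (y j * (h j)\<^sup>2) + (y i * (h i)\<^sup>2) * (g j * y j)
      - lo * ((y i * (h i)\<^sup>2) * y j + y i * (y j * (h j)\<^sup>2))
      - 2 * ((g i * y i * h i) * (y j * h j) + (y i * h i) * (g j * y j * h j) - lo * ((y i * h i) * (y j * h j))))"
    by (intro sum.cong refl) (simp add: power2_eq_square algebra_simps)
  \<comment> \<open>The literal factors 1 and 0 stand for the sums of \<open>y i\<close> and of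
    \<open>y i * h i\<close>; unfolding the reversed assumptions turns them back into those
    sums.\<close>
  also have "\<dots> = T * 1 + 1 * T + m * S + S * m - lo * (S * 1 + 1 * S) - 2 * (H * 0 + 0 * H - lo * (0 * 0))"
    unfolding T_def S_def H_def m_def y(2)[symmetric] h[symmetric]
    by (simp only: sum.distrib sum_subtractf | simp only: flip: sum_distrib_left
        | simp only: flip: sum_distrib_right)+
  finally have "lo * S \<le> T + m * S" by (simp add: algebra_simps)
  also have "T + m * S = (\<Sum>i<N. y i * (g i + m) * (h i)\<^sup>2)"
    by (simp add: T_def S_def sum_distrib_left sum.distrib distrib_left distrib_right mult_ac)
  finally show ?thesis by (simp add: S_def m_def)
qed

lemma negB_eigenvalue:
  fixes v :: "nat \<Rightarrow> complex" and \<mu> :: complex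
  assumes y: "\<And>i. i < N \<Longrightarrow> 0 \<le> y i" "(\<Sum>i<N. y i) = 1"
    and inj: "inj_on g {..<N}"
    and f: "\<And>i j. i < N \<Longrightarrow> j < N \<Longrightarrow> i \<noteq> j \<Longrightarrow> lo \<le> g i + g j \<and> g i + g j \<le> hi"
    and v: "(\<Sum>i<N. v i) = 0" "\<exists>i<N. v i \<noteq> 0"
    and eig: "\<And>i. i < N \<Longrightarrow> negB g N y v i = \<mu> * v i"
  shows "\<mu> \<in> complex_of_real ` {lo..hi}"
proof -
  define m where "m = (\<Sum>j<N. g j * y j)"
  define a where "a i = g i + m" for i
  define G where "G = (\<Sum>j<N. of_real (g j) * v j)"
  have eq: "(of_real (a i) - \<mu>) * v i = of_real (y i) * G" if "i < N" for i
    using eig[OF that] by (simp add: negB_def a_def m_def G_def algebra_simps)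
  \<comment> \<open>If \<open>G\<close> vanished, \<open>v\<close> would be supported where
    \<open>a i = \<mu>\<close>. As \<open>g\<close> is injective, that is at most one index, and a
    single nonzero entry cannot sum to zero.\<close>
  have G0: "G \<noteq> 0"
  proof
    assume "G = 0"
    then have *: "v i = 0 \<or> of_real (a i) = \<mu>" if "i < N" for i using eq[OF that] by auto
    obtain k where k: "k < N" "v k \<noteq> 0" using v(2) by blast
    have "v i = 0" if "i < N" "i \<noteq> k" for i
    proof (rule ccontr)
      assume "v i \<noteq> 0"
      then have "complex_of_real (a i) = of_real (a k)" using *[OF that(1)] *[OF k(1)] k by auto
      then have "g i = g k" by (simp add: a_def)
      then show False using inj that k by (auto simp: inj_on_def)
    qed
    then have "(\<Sum>i<N. v i) = (\<Sum>i\<in>{k}. v i)" using k by (intro sum.mono_neutral_right) auto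
    then show False using v(1) k by simp
  qed
  show ?thesis
  proof (cases "\<exists>i<N. of_real (a i) = \<mu>")
    case True
    then obtain i where i: "i < N" "of_real (a i) = \<mu>" by blast
    \<comment> \<open>This deletes the pair \<open>(i, i)\<close> from the average below, so that
      only sums over distinct indices carry weight.\<close>
    then have yi: "y i = 0" using eq[OF i(1)] G0 by auto
    have "a i = g i * (\<Sum>j<N. y j) + m" by (simp add: a_def y)
    then have ai: "a i = (\<Sum>j<N. (g i + g j) * y j)"
      by (simp add: m_def sum_distrib_left sum.distrib distrib_right)
    have b: "lo * y j \<le> (g i + g j) * y j" "(g i + g j) * y j \<le> hi * y j" if "j < N" for j
      using f[OF i(1) that] y(1)[OF that] yi by (cases "j = i"; auto intro!: mult_right_mono)+
    have "(\<Sum>j<N. lo * y j) \<le> a i" "a i \<le> (\<Sum>j<N. hi * y j)"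
      unfolding ai using b by (intro sum_mono; simp)+
    then have "a i \<in> {lo..hi}" using y(2) by (simp flip: sum_distrib_left)
    then show ?thesis using i(2) by blast
  next
    case False
    define h where "h i = 1 / (of_real (a i) - \<mu>)" for i
    have v_eq: "v i = G * (of_real (y i) * h i)" if "i < N" for i
      using eq[OF that] False that by (auto simp: h_def field_simps)
    have "G * (\<Sum>i<N. of_real (y i) * h i) = 0"
      using v(1) by (simp add: v_eq sum_distrib_left cong: sum.cong_simp)
    then have yh: "(\<Sum>i<N. of_real (y i) * h i) = 0" using G0 by simp
    define S where "S = (\<Sum>i<N. y i * (cmod (h i))\<^sup>2)"
    define T where "T = (\<Sum>i<N. y i * a i * (cmod (h i))\<^sup>2)"
    have h0: "h i \<noteq> 0" if "i < N" for i using False that by (auto simp: h_def)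
    have S: "S > 0"
    proof -
      have "\<not> (\<forall>i\<in>{..<N}. y i = 0)" using y(2) by (metis sum.neutral zero_neq_one)
      then obtain k where k: "k < N" "y k > 0" using y(1) by (auto simp: less_le)
      then show ?thesis unfolding S_def using y(1) h0[OF k(1)]
        by (intro sum_pos2[of _ k]) auto
    qed
    \<comment> \<open>Multiply \<open>(a i - \<mu>) * h i = 1\<close> by \<open>cnj (h i)\<close>.
      Weighted by \<open>y\<close>, the right-hand sides sum to zero, which gives
      \<open>T = \<mu> * S\<close>.\<close>
    have h_sq: "of_real (a i) * of_real ((cmod (h i))\<^sup>2) - \<mu> * of_real ((cmod (h i))\<^sup>2) = cnj (h i)"
      if "i < N" for i
    proof -
      have "(of_real (a i) - \<mu>) * h i = 1" using False that by (simp add: h_def)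
      then have "(of_real (a i) - \<mu>) * h i * cnj (h i) = cnj (h i)" by simp
      then show ?thesis by (simp add: complex_norm_square left_diff_distrib mult.assoc del: of_real_power)
    qed
    have "of_real T - \<mu> * of_real S
        = (\<Sum>i<N. of_real (y i) * (of_real (a i) * of_real ((cmod (h i))\<^sup>2) - \<mu> * of_real ((cmod (h i))\<^sup>2)))"
      by (simp add: T_def S_def sum_distrib_left sum_subtractf algebra_simps)
    also have "\<dots> = cnj (\<Sum>i<N. of_real (y i) * h i)"
      by (simp add: h_sq del: of_real_power cong: sum.cong_simp)
    finally have "of_real T = \<mu> * of_real S" by (simp only: yh) simp
    then have lam: "\<mu> = of_real (T / S)" using S by (simp add: field_simps)
    have Re0: "(\<Sum>i<N. y i * Re (h i)) = 0" and Im0: "(\<Sum>i<N. y i * Im (h i)) = 0"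
      using arg_cong[OF yh, of Re] arg_cong[OF yh, of Im] by simp_all
    \<comment> \<open>The real inequality is applied to the real and imaginary parts of
      \<open>h\<close>. The nodes \<open>u\<close> stay general: \<open>u = g\<close> yields the
      lower end of the interval, the negated nodes yield the upper end.\<close>
    have bound: "c * S \<le> (\<Sum>i<N. y i * (u i + (\<Sum>j<N. u j * y j)) * (cmod (h i))\<^sup>2)"
      if "\<And>i j. i < N \<Longrightarrow> j < N \<Longrightarrow> i \<noteq> j \<Longrightarrow> c \<le> u i + u j" for c u
    proof -
      have "c * (\<Sum>i<N. y i * (Re (h i))\<^sup>2)
            \<le> (\<Sum>i<N. y i * (u i + (\<Sum>j<N. u j * y j)) * (Re (h i))\<^sup>2)"
        using y Re0 that by (rule weighted_variance_lower_bound)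
      moreover have "c * (\<Sum>i<N. y i * (Im (h i))\<^sup>2)
            \<le> (\<Sum>i<N. y i * (u i + (\<Sum>j<N. u j * y j)) * (Im (h i))\<^sup>2)"
        using y Im0 that by (rule weighted_variance_lower_bound)
      ultimately show ?thesis
        by (simp add: S_def cmod_power2 distrib_left[of _ "(Re _)\<^sup>2"] distrib_left[of c] sum.distrib)
    qed
    have "lo * S \<le> T" using bound[of lo g] f by (auto simp: T_def a_def m_def)
    moreover have "- hi * S \<le> - T"
    proof -
      have "- hi * S \<le> (\<Sum>i<N. y i * (- g i + (\<Sum>j<N. - g j * y j)) * (cmod (h i))\<^sup>2)"
        using f by (intro bound) force
      also have "\<dots> = - T"
      proof -
        have "y i * (- g i + (\<Sum>j<N. - g j * y j)) = - (y i * a i)" for i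
          by (simp add: a_def m_def sum_negf algebra_simps)
        then show ?thesis by (simp add: T_def sum_negf)
      qed
      finally show ?thesis .
    qed
    ultimately have "T / S \<in> {lo..hi}" using S by (simp add: pos_le_divide_eq pos_divide_le_eq)
    then show ?thesis unfolding lam by blast
  qed
qed

section \<open>Linearity and injectivity of the moment map and of the operator\<close>

lemma mom_cong: "(\<And>i. i < N \<Longrightarrow> v i = w i) \<Longrightarrow> mom g N v l = mom g N w l"
  by (simp add: mom_def)

lemma mom_lincomb:
  "mom g N (\<lambda>i. \<Sum>k\<in>S. c k * v k i) l = (\<Sum>k\<in>S. c k * mom g N (v k) l)"
  unfolding mom_def sum_distrib_left by (subst sum.swap) (simp add: mult_ac)

lemma negB_lincomb:
  fixes c :: "'b \<Rightarrow> 'a::real_normed_field"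
  shows "negB g N y (\<lambda>i. \<Sum>k\<in>S. c k * v k i) i = (\<Sum>k\<in>S. c k * negB g N y (v k) i)"
proof -
  define a where "a = (of_real (g i + (\<Sum>j<N. g j * y j)) :: 'a)"
  define G where "G k = (\<Sum>j<N. of_real (g j) * v k j)" for k
  have "(\<Sum>j<N. of_real (g j) * (\<Sum>k\<in>S. c k * v k j)) = (\<Sum>k\<in>S. c k * G k)"
    unfolding G_def sum_distrib_left by (subst sum.swap) (simp add: mult_ac)
  then have "negB g N y (\<lambda>i. \<Sum>k\<in>S. c k * v k i) i
      = a * (\<Sum>k\<in>S. c k * v k i) - of_real (y i) * (\<Sum>k\<in>S. c k * G k)"
    by (simp only: negB_def a_def)
  also have "\<dots> = (\<Sum>k\<in>S. c k * (a * v k i - of_real (y i) * G k))"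
    by (simp add: sum_distrib_left right_diff_distrib sum_subtractf mult_ac)
  finally show ?thesis by (simp only: negB_def a_def G_def)
qed

lemma mom_of_real: "mom g N (\<lambda>i. of_real (v i)) l = of_real (mom g N v l)"
  by (simp add: mom_def)

lemma negB_of_real: "negB g N y (\<lambda>i. of_real (v i)) i = of_real (negB g N y v i)"
  by (simp add: negB_def)

lemma mom_diff: "mom g N (\<lambda>i. v i - w i) l = mom g N v l - mom g N w l"
  by (simp add: mom_def right_diff_distrib sum_subtractf del: power_Suc)

lemma negB_diff: "negB g N y (\<lambda>i. v i - w i) i = negB g N y v i - negB g N y w i"
  by (simp add: negB_def right_diff_distrib sum_subtractf)

lemma mom_inj:
  fixes v w :: "nat \<Rightarrow> 'a::real_normed_field"
  assumes "inj_on g {..<N}" and "(\<Sum>i<N. v i) = 0" "(\<Sum>i<N. w i) = 0"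
    and eq: "\<And>l. l < N - 1 \<Longrightarrow> mom g N v l = mom g N w l" and i: "i < N"
  shows "v i = w i"
proof -
  obtain C :: real where C: "\<And>v :: nat \<Rightarrow> 'a. (\<Sum>i<N. v i) = 0 \<Longrightarrow>
      (\<Sum>i<N. norm (v i)) \<le> C * (\<Sum>l<N - 1. norm (mom g N v l))"
    using mom_bounded_below[OF assms(1)] by metis
  have "(\<Sum>i<N. norm (v i - w i)) \<le> C * (\<Sum>l<N - 1. norm (mom g N (\<lambda>i. v i - w i) l))"
    by (rule C) (simp add: sum_subtractf assms)
  also have "\<dots> = 0" by (simp add: mom_diff eq)
  finally have "(\<Sum>i<N. norm (v i - w i)) = 0" by (simp add: sum_nonneg antisym)
  then show ?thesis using i by (simp add: sum_nonneg_eq_0_iff)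
qed

text \<open>The case \<open>z = 1\<close>, \<open>r = 0\<close>, \<open>e = s = 1\<close> of the
  resolvent bound.\<close>

lemma negB_bounded_below:
  fixes v :: "nat \<Rightarrow> complex"
  assumes y: "\<And>i. i < N \<Longrightarrow> 0 \<le> y i" "(\<Sum>i<N. y i) = 1"
    and a: "\<And>i. i < N \<Longrightarrow> \<alpha> \<le> g i + (\<Sum>j<N. g j * y j) \<and> g i + (\<Sum>j<N. g j * y j) \<le> \<beta>"
    and \<alpha>: "0 < \<alpha>" "\<alpha> \<le> 1" and \<beta>: "1 \<le> \<beta>"
    and v: "(\<Sum>i<N. v i) = 0"
  shows "(\<Sum>i<N. cmod (v i)) \<le> (1 + \<beta> / \<alpha>) / \<alpha> * (\<Sum>i<N. cmod (negB g N y v i))"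
  using negB_resolvent_bound[OF y a \<alpha> \<beta>, of 1 1 1 0 v] v by simp

lemma negB_inj:
  fixes v w :: "nat \<Rightarrow> complex"
  assumes y: "\<And>i. i < N \<Longrightarrow> 0 \<le> y i" "(\<Sum>i<N. y i) = 1"
    and a: "\<And>i. i < N \<Longrightarrow> 0 < g i + (\<Sum>j<N. g j * y j)"
    and "(\<Sum>i<N. v i) = 0" "(\<Sum>i<N. w i) = 0"
    and eq: "\<And>i. i < N \<Longrightarrow> negB g N y v i = negB g N y w i" and i: "i < N"
  shows "v i = w i"
proof -
  define A where "A = (\<lambda>i. g i + (\<Sum>j<N. g j * y j)) ` {..<N}"
  \<comment> \<open>Inserting 1 into the finite set of diagonal coefficients ensures
    \<open>\<alpha> \<le> 1 \<le> \<beta>\<close>.\<close>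
  define \<alpha> where "\<alpha> = Min (insert 1 A)"
  define \<beta> where "\<beta> = Max (insert 1 A)"
  have "(\<Sum>i<N. cmod (v i - w i)) \<le> (1 + \<beta> / \<alpha>) / \<alpha> * (\<Sum>i<N. cmod (negB g N y (\<lambda>i. v i - w i) i))"
    by (rule negB_bounded_below[OF y])
       (auto simp: \<alpha>_def \<beta>_def A_def a sum_subtractf assms intro!: Min_le Max_ge)
  also have "\<dots> = 0" by (simp add: negB_diff eq)
  finally have "(\<Sum>i<N. cmod (v i - w i)) = 0" by (simp add: sum_nonneg antisym)
  then show ?thesis using i by (simp add: sum_nonneg_eq_0_iff)
qed

section \<open>Norms of vectors and matrices\<close>

lemma enorm_le_sum: "enorm v \<le> (\<Sum>i<dim_vec v. norm (v $ i))"
  unfolding enorm_def by (rule L2_set_le_sum) simp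

text \<open>The estimates above are in the sum norm; together with \<open>enorm_le_sum\<close> this
  passes to the Euclidean norm at the price of the dimension.\<close>

lemma sum_le_enorm: "(\<Sum>i<dim_vec v. norm (v $ i)) \<le> real (dim_vec v) * enorm v"
proof -
  have "(\<Sum>i<dim_vec v. norm (v $ i)) \<le> (\<Sum>i<dim_vec v. enorm v)"
    unfolding enorm_def by (intro sum_mono member_le_L2_set) auto
  then show ?thesis by simp
qed

lemma enorm_nonneg [simp]: "0 \<le> enorm v"
  by (simp add: enorm_def L2_set_nonneg)

lemma enorm_zero_iff: "enorm v = 0 \<longleftrightarrow> v = 0\<^sub>v (dim_vec v)"
  unfolding enorm_def by (subst L2_set_eq_0_iff) (auto simp: vec_eq_iff)

lemma enorm_of_real: "enorm (map_vec complex_of_real x) = enorm x"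
  by (simp add: enorm_def L2_set_def)

lemma opnorm_le:
  assumes "0 \<le> C" and "\<And>x. x \<in> carrier_vec (dim_col M) \<Longrightarrow> enorm (M *\<^sub>v x) \<le> C * enorm x"
  shows "opnorm M \<le> C"
  unfolding opnorm_def
proof (rule cSup_least)
  have "enorm (0\<^sub>v (dim_col M) :: 'a vec) \<le> 1" using enorm_zero_iff[of "0\<^sub>v (dim_col M) :: 'a vec"] by simp
  then show "{enorm (M *\<^sub>v x) |x. x \<in> carrier_vec (dim_col M) \<and> enorm x \<le> 1} \<noteq> {}"
    by (auto intro!: exI[of _ "0\<^sub>v (dim_col M)"])
  fix t assume "t \<in> {enorm (M *\<^sub>v x) |x. x \<in> carrier_vec (dim_col M) \<and> enorm x \<le> 1}"
  then obtain x where x: "t = enorm (M *\<^sub>v x)" "x \<in> carrier_vec (dim_col M)" "enorm x \<le> 1" by auto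
  have "t \<le> C * enorm x" using assms(2) x by auto
  also have "\<dots> \<le> C * 1" using assms(1) x by (intro mult_left_mono) auto
  finally show "t \<le> C" by simp
qed

text \<open>A lower bound excludes a kernel, so the determinant is nonzero and
  \<open>mat_inverse\<close> returns a genuine inverse, which gives \<open>minv\<close> its meaning.
  Applied to a preimage, the same bound controls the inverse.\<close>

lemma bounded_below_invertible:
  fixes M :: "'a::real_normed_field mat"
  assumes M: "M \<in> carrier_mat n n" and C: "0 \<le> C"
    and lower: "\<And>x. x \<in> carrier_vec n \<Longrightarrow> enorm x \<le> C * enorm (M *\<^sub>v x)"
  shows "invertible_mat M" "opnorm (minv M) \<le> C"
proof -
  have "det M \<noteq> 0"
  proof
    assume "det M = 0"
    then obtain v where v: "v \<in> carrier_vec n" "v \<noteq> 0\<^sub>v n" "M *\<^sub>v v = 0\<^sub>v n"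
      using det_0_iff_vec_prod_zero[OF M] by auto
    have "enorm v \<le> C * enorm (0\<^sub>v n :: 'a vec)" using lower[OF v(1)] v(3) by simp
    also have "enorm (0\<^sub>v n :: 'a vec) = 0" by (simp add: enorm_zero_iff)
    finally have "enorm v = 0" by (simp add: antisym)
    then show False using v enorm_zero_iff[of v] by auto
  qed
  then have "M \<in> Units (ring_mat TYPE('a) n ())" by (rule det_non_zero_imp_unit[OF M])
  then obtain B where B: "mat_inverse M = Some B"
    using mat_inverse(1)[OF M, where b = "()"] by (cases "mat_inverse M") auto
  then have MB: "M * B = 1\<^sub>m n" "B * M = 1\<^sub>m n" "B \<in> carrier_mat n n"
    using mat_inverse(2)[OF M] by auto
  then show "invertible_mat M"
    using M unfolding invertible_mat_def inverts_mat_def by auto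
  have "minv M = B" by (simp add: minv_def B)
  moreover have "opnorm B \<le> C"
  proof (rule opnorm_le[OF C])
    fix x :: "'a vec" assume "x \<in> carrier_vec (dim_col B)"
    then have x: "x \<in> carrier_vec n" using MB by simp
    have "M *\<^sub>v (B *\<^sub>v x) = x"
      using assoc_mult_mat_vec[OF M MB(3) x] MB(1) x by simp
    then show "enorm (B *\<^sub>v x) \<le> C * enorm x"
      using lower[of "B *\<^sub>v x"] MB(3) x by simp
  qed
  ultimately show "opnorm (minv M) \<le> C" by simp
qed

lemma smult_mat_mult_vec:
  fixes A :: "'a::comm_ring_1 mat"
  assumes "x \<in> carrier_vec (dim_col A)"
  shows "(c \<cdot>\<^sub>m A) *\<^sub>v x = c \<cdot>\<^sub>v (A *\<^sub>v x)"
  using assms by (auto simp: vec_eq_iff scalar_prod_def sum_distrib_left mult_ac)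

lemma cmat_mult_vec:
  assumes "A \<in> carrier_mat m n" "x \<in> carrier_vec n"
  shows "cmat A *\<^sub>v map_vec complex_of_real x = map_vec complex_of_real (A *\<^sub>v x)"
  using assms by (auto simp: vec_eq_iff scalar_prod_def)

section \<open>Matrices inverting the operator in moment coordinates\<close>

text \<open>The matrix form of \<open>A L (-B) v = L v\<close>, which avoids the inverses of \<open>L\<close> and \<open>B\<close>.\<close>

definition inverts_negB :: "(nat \<Rightarrow> real) \<Rightarrow> nat \<Rightarrow> (nat \<Rightarrow> real) \<Rightarrow> real mat \<Rightarrow> bool" where
  "inverts_negB g N y A \<longleftrightarrow>
     A \<in> carrier_mat (N - 1) (N - 1) \<and> (\<forall>i<N. 0 \<le> y i) \<and> (\<Sum>i<N. y i) = 1 \<and>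
     (\<forall>v :: nat \<Rightarrow> complex. (\<Sum>i<N. v i) = 0 \<longrightarrow>
        (\<forall>l<N - 1. (\<Sum>k<N - 1. of_real (A $$ (l, k)) * mom g N (negB g N y v) k) = mom g N v l))"

section \<open>Uniform estimates for positive increasing nodes\<close>

locale positive_nodes =
  fixes N :: nat and g :: "nat \<Rightarrow> real"
  assumes N: "2 \<le> N" and g_pos: "0 < g 0" and mono: "strict_mono_on {..<N} g"
begin

lemma inj: "inj_on g {..<N}"
  using mono by (rule strict_mono_on_imp_inj_on)

lemma g_bounds: "i < N \<Longrightarrow> g 0 \<le> g i \<and> g i \<le> g (N - 1)"
  using N strict_mono_on_leD[OF mono, of 0 i] strict_mono_on_leD[OF mono, of i "N - 1"] by auto

lemma mean_bounds:
  assumes y: "\<And>i. i < N \<Longrightarrow> 0 \<le> y i" "(\<Sum>i<N. y i) = 1"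
  shows "0 \<le> (\<Sum>j<N. g j * y j)" "(\<Sum>j<N. g j * y j) \<le> g (N - 1)"
proof -
  show "0 \<le> (\<Sum>j<N. g j * y j)"
    using y g_bounds g_pos by (intro sum_nonneg mult_nonneg_nonneg) (auto intro: order_trans less_imp_le)
  have "(\<Sum>j<N. g j * y j) \<le> (\<Sum>j<N. g (N - 1) * y j)"
    using y g_bounds by (intro sum_mono mult_right_mono) auto
  then show "(\<Sum>j<N. g j * y j) \<le> g (N - 1)" using y by (simp flip: sum_distrib_left)
qed

text \<open>\<open>\<alpha>\<close> and \<open>\<beta>\<close> bound all diagonal coefficients
  \<open>a\<^sub>i\<close> uniformly in \<open>y\<close>; the cuts at 1 meet the requirements of
  \<open>negB_resolvent_bound\<close>.\<close>

definition "\<alpha> = min 1 (g 0)"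
definition "\<beta> = max 1 (2 * g (N - 1))"

lemma diag_bounds:
  assumes y: "\<And>i. i < N \<Longrightarrow> 0 \<le> y i" "(\<Sum>i<N. y i) = 1" and "i < N"
  shows "\<alpha> \<le> g i + (\<Sum>j<N. g j * y j) \<and> g i + (\<Sum>j<N. g j * y j) \<le> \<beta>"
  using mean_bounds[OF y] g_bounds[OF assms(3)] by (auto simp: \<alpha>_def \<beta>_def)

lemma \<alpha>_\<beta>: "0 < \<alpha>" "\<alpha> \<le> 1" "1 \<le> \<beta>"
  using g_pos by (auto simp: \<alpha>_def \<beta>_def)

lemma negB_preimage:
  fixes x :: "'a::real_normed_field vec"
  assumes y: "\<And>i. i < N \<Longrightarrow> 0 \<le> y i" "(\<Sum>i<N. y i) = 1"
  obtains v where "(\<Sum>i<N. v i) = 0" "\<And>l. l < N - 1 \<Longrightarrow> mom g N (negB g N y v) l = x $ l"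
proof -
  obtain u where u: "(\<Sum>i<N. u i) = 0" "\<And>l. l < N - 1 \<Longrightarrow> mom g N u l = x $ l"
    using mom_surj[OF inj, of "\<lambda>l. x $ l"] N by auto
  have pos: "0 < g i + (\<Sum>j<N. g j * y j)" if "i < N" for i
    using diag_bounds[OF y that] \<alpha>_\<beta> by linarith
  obtain v where v: "(\<Sum>i<N. v i) = 0" "\<And>i. i < N \<Longrightarrow> negB g N y v i = u i"
    using negB_surj[OF y pos u(1)] by auto
  have "mom g N (negB g N y v) l = mom g N u l" for l using v(2) by (rule mom_cong)
  with u v that show ?thesis by auto
qed

text \<open>Writing \<open>x\<close> as \<open>L (-B) v\<close> turns \<open>A x\<close> into
  \<open>L v\<close>, so questions about the matrix become questions about \<open>negB\<close> on
  zero-sum vectors.\<close>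

lemma inverts_negB_preimage:
  fixes x :: "complex vec"
  assumes A: "inverts_negB g N y A" and x: "x \<in> carrier_vec (N - 1)"
  obtains v where "(\<Sum>i<N. v i) = 0" "\<And>l. l < N - 1 \<Longrightarrow> x $ l = mom g N (negB g N y v) l"
    "\<And>l. l < N - 1 \<Longrightarrow> (cmat A *\<^sub>v x) $ l = mom g N v l"
proof -
  obtain v where v: "(\<Sum>i<N. v i) = 0" "\<And>l. l < N - 1 \<Longrightarrow> mom g N (negB g N y v) l = x $ l"
    using negB_preimage[of y x] A unfolding inverts_negB_def by auto
  have "(cmat A *\<^sub>v x) $ l = mom g N v l" if "l < N - 1" for l
  proof -
    have "(cmat A *\<^sub>v x) $ l = (\<Sum>k<N - 1. of_real (A $$ (l, k)) * x $ k)"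
      using A x that by (auto simp: inverts_negB_def scalar_prod_def lessThan_atLeast0)
    also have "\<dots> = (\<Sum>k<N - 1. of_real (A $$ (l, k)) * mom g N (negB g N y v) k)"
      using v(2) by simp
    also have "\<dots> = mom g N v l" using A v(1) that by (simp add: inverts_negB_def)
    finally show ?thesis .
  qed
  with v that show ?thesis by metis
qed

text \<open>With \<open>x = L (-B) v\<close>, the matrix sends \<open>x\<close> to
  \<open>L (z (-B) v + r v)\<close>, to which the resolvent bound of \<open>negB\<close> applies.
  The constant is fixed before \<open>y\<close> and \<open>A\<close>, whence the uniformity in
  \<open>U\<close>.\<close>

lemma inverts_negB_resolvent:
  assumes s: "0 < s"
  obtains C where "0 \<le> C"
    "\<And>y A x z e r. inverts_negB g N y A \<Longrightarrow> x \<in> carrier_vec (N - 1) \<Longrightarrow> cmod e = 1 \<Longrightarrow>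
       s * cmod z \<le> Re (e * z) \<Longrightarrow> s \<le> Re e \<Longrightarrow> 0 \<le> r \<Longrightarrow> 0 < cmod z + r \<Longrightarrow>
       enorm x \<le> C / (cmod z + r) * enorm ((z \<cdot>\<^sub>m 1\<^sub>m (N - 1) + cmat (r \<cdot>\<^sub>m A)) *\<^sub>v x)"
proof -
  obtain C1 where C1: "0 \<le> C1" "\<And>v :: nat \<Rightarrow> complex. (\<Sum>i<N. v i) = 0 \<Longrightarrow>
       (\<Sum>i<N. norm (v i)) \<le> C1 * (\<Sum>l<N - 1. norm (mom g N v l))"
    using mom_bounded_below[OF inj, where 'a = complex] by metis
  obtain C2 where C2: "0 \<le> C2" "\<And>v :: nat \<Rightarrow> complex.
       (\<Sum>l<N - 1. norm (mom g N v l)) \<le> C2 * (\<Sum>i<N. norm (v i))"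
    using mom_bounded[where 'a = complex] by metis
  define C3 where "C3 = 3 * g (N - 1)"
  define C4 where "C4 = (1 + \<beta> / (\<alpha> * s * s)) / (\<alpha> * s)"
  have C3: "0 \<le> C3" using g_bounds[of 0] g_pos N by (simp add: C3_def)
  have C4: "0 \<le> C4" using \<alpha>_\<beta> s by (simp add: C4_def)
  \<comment> \<open>The factors follow the chain from \<open>x\<close> through
    \<open>(-B) v\<close>, \<open>v\<close> and \<open>w\<close> to \<open>M x\<close>; the
    dimension enters through the comparison of norms.\<close>
  define C where "C = C2 * C3 * C4 * C1 * real (N - 1)"
  show ?thesis
  proof
    show "0 \<le> C" using C1(1) C2(1) C3 C4 by (simp add: C_def)
    fix y A e z r and x :: "complex vec"
    assume A: "inverts_negB g N y A" and x: "x \<in> carrier_vec (N - 1)" and e: "cmod e = 1"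
       "s * cmod z \<le> Re (e * z)" "s \<le> Re e" and r: "0 \<le> r" "0 < cmod z + r"
    define M where "M = z \<cdot>\<^sub>m 1\<^sub>m (N - 1) + cmat (r \<cdot>\<^sub>m A)"
    have y: "\<And>i. i < N \<Longrightarrow> 0 \<le> y i" "(\<Sum>i<N. y i) = 1" and A': "A \<in> carrier_mat (N - 1) (N - 1)"
      using A by (auto simp: inverts_negB_def)
    obtain v where v: "(\<Sum>i<N. v i) = 0" "\<And>l. l < N - 1 \<Longrightarrow> x $ l = mom g N (negB g N y v) l"
      "\<And>l. l < N - 1 \<Longrightarrow> (cmat A *\<^sub>v x) $ l = mom g N v l"
      using inverts_negB_preimage[OF A x] by metis
    define w where "w i = z * negB g N y v i + of_real r * v i" for i
    have w0: "(\<Sum>i<N. w i) = 0"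
      using v(1) sum_negB[OF y(2) v(1)] by (simp add: w_def sum.distrib flip: sum_distrib_left)
    have dim: "dim_vec (M *\<^sub>v x) = N - 1" using A' by (simp add: M_def)
    have Mx: "(M *\<^sub>v x) $ l = mom g N w l" if l: "l < N - 1" for l
    proof -
      have "M *\<^sub>v x = z \<cdot>\<^sub>v x + of_real r \<cdot>\<^sub>v (cmat A *\<^sub>v x)"
      proof -
        have "cmat (r \<cdot>\<^sub>m A) = of_real r \<cdot>\<^sub>m cmat A" by (rule eq_matI) auto
        then show ?thesis using A' x
          by (simp add: M_def add_mult_distrib_mat_vec[of _ "N - 1" "N - 1"] smult_mat_mult_vec)
      qed
      then have "(M *\<^sub>v x) $ l = z * mom g N (negB g N y v) l + of_real r * mom g N v l"
        using l A' x v by simp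
      also have "\<dots> = mom g N w l"
        by (simp add: mom_def w_def distrib_left sum.distrib sum_distrib_left mult_ac)
      finally show ?thesis .
    qed
    have "enorm x \<le> (\<Sum>l<N - 1. cmod (mom g N (negB g N y v) l))"
      using enorm_le_sum[of x] x v(2) by simp
    also have "\<dots> \<le> C2 * (\<Sum>i<N. cmod (negB g N y v i))" by (rule C2)
    also have "\<dots> \<le> C2 * (C3 * (\<Sum>i<N. cmod (v i)))"
      unfolding C3_def using g_bounds g_pos C2(1)
      by (intro mult_left_mono negB_bounded y) (auto intro: order_trans less_imp_le)
    also have "\<dots> \<le> C2 * (C3 * (C4 / (cmod z + r) * (\<Sum>i<N. cmod (w i))))"
      unfolding C4_def w_def
      by (intro mult_left_mono C2(1) C3 negB_resolvent_bound[OF y diag_bounds[OF y] \<alpha>_\<beta> e s r v(1)])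
    also have "\<dots> \<le> C2 * (C3 * (C4 / (cmod z + r) * (C1 * (\<Sum>l<N - 1. cmod (mom g N w l)))))"
      using C2(1) C3 C4 r by (intro mult_left_mono C1 w0) auto
    also have "(\<Sum>l<N - 1. cmod (mom g N w l)) = (\<Sum>l<N - 1. cmod ((M *\<^sub>v x) $ l))"
      by (simp add: Mx)
    also have "C2 * (C3 * (C4 / (cmod z + r) * (C1 * \<dots>)))
        \<le> C2 * (C3 * (C4 / (cmod z + r) * (C1 * (real (N - 1) * enorm (M *\<^sub>v x)))))"
      using C1(1) C2(1) C3 C4 r sum_le_enorm[of "M *\<^sub>v x"] unfolding dim
      by (intro mult_left_mono) auto
    also have "\<dots> = C / (cmod z + r) * enorm (M *\<^sub>v x)" by (simp add: C_def)
    finally show "enorm x \<le> C / (cmod z + r) * enorm ((z \<cdot>\<^sub>m 1\<^sub>m (N - 1) + cmat (r \<cdot>\<^sub>m A)) *\<^sub>v x)"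
      unfolding M_def .
  qed
qed

text \<open>A chain of the same kind: \<open>A x = L v\<close> is bounded by \<open>v\<close>, then
  by \<open>(-B) v\<close>, hence by \<open>x\<close>.\<close>

lemma inverts_negB_bounded:
  obtains C where "0 \<le> C"
    "\<And>y A x. inverts_negB g N y A \<Longrightarrow> x \<in> carrier_vec (N - 1) \<Longrightarrow>
       enorm (cmat A *\<^sub>v x) \<le> C * enorm x"
proof -
  obtain C1 where C1: "0 \<le> C1" "\<And>v :: nat \<Rightarrow> complex. (\<Sum>i<N. v i) = 0 \<Longrightarrow>
       (\<Sum>i<N. norm (v i)) \<le> C1 * (\<Sum>l<N - 1. norm (mom g N v l))"
    using mom_bounded_below[OF inj, where 'a = complex] by metis
  obtain C2 where C2: "0 \<le> C2" "\<And>v :: nat \<Rightarrow> complex.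
       (\<Sum>l<N - 1. norm (mom g N v l)) \<le> C2 * (\<Sum>i<N. norm (v i))"
    using mom_bounded[where 'a = complex] by metis
  define C3 where "C3 = (1 + \<beta> / \<alpha>) / \<alpha>"
  have C3: "0 \<le> C3" using \<alpha>_\<beta> by (simp add: C3_def)
  show ?thesis
  proof
    show "0 \<le> C2 * C3 * C1 * real (N - 1)" using C1(1) C2(1) C3 by simp
    fix y A and x :: "complex vec"
    assume A: "inverts_negB g N y A" and x: "x \<in> carrier_vec (N - 1)"
    have y: "\<And>i. i < N \<Longrightarrow> 0 \<le> y i" "(\<Sum>i<N. y i) = 1" and A': "A \<in> carrier_mat (N - 1) (N - 1)"
      using A by (auto simp: inverts_negB_def)
    obtain v where v: "(\<Sum>i<N. v i) = 0" "\<And>l. l < N - 1 \<Longrightarrow> x $ l = mom g N (negB g N y v) l"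
      "\<And>l. l < N - 1 \<Longrightarrow> (cmat A *\<^sub>v x) $ l = mom g N v l"
      using inverts_negB_preimage[OF A x] by metis
    have "enorm (cmat A *\<^sub>v x) \<le> (\<Sum>l<N - 1. cmod (mom g N v l))"
      using enorm_le_sum[of "cmat A *\<^sub>v x"] A' v(3) by simp
    also have "\<dots> \<le> C2 * (\<Sum>i<N. cmod (v i))" by (rule C2)
    also have "\<dots> \<le> C2 * (C3 * (\<Sum>i<N. cmod (negB g N y v i)))"
      unfolding C3_def
      by (intro mult_left_mono C2(1) negB_bounded_below[OF y diag_bounds[OF y] \<alpha>_\<beta> v(1)])
    also have "\<dots> \<le> C2 * (C3 * (C1 * (\<Sum>l<N - 1. cmod (mom g N (negB g N y v) l))))"
      using C2(1) C3 by (intro mult_left_mono C1 sum_negB y v) auto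
    also have "(\<Sum>l<N - 1. cmod (mom g N (negB g N y v) l)) = (\<Sum>l<N - 1. cmod (x $ l))"
      by (simp add: v(2))
    also have "C2 * (C3 * (C1 * \<dots>)) \<le> C2 * (C3 * (C1 * (real (N - 1) * enorm x)))"
      using C1(1) C2(1) C3 sum_le_enorm[of x] x by (intro mult_left_mono) auto
    finally show "enorm (cmat A *\<^sub>v x) \<le> C2 * C3 * C1 * real (N - 1) * enorm x"
      by (simp add: mult_ac)
  qed
qed

text \<open>An eigenvector \<open>x = L (-B) v\<close> of \<open>A\<close> for \<open>\<mu>\<close>
  satisfies \<open>v = \<mu> (-B) v\<close>. Hence \<open>1 / \<mu>\<close> is an eigenvalue of
  \<open>-B\<close>, and reciprocals swap the ends of its interval.\<close>

lemma inverts_negB_spectrum: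
  assumes A: "inverts_negB g N y A"
    and f: "\<And>i j. i < N \<Longrightarrow> j < N \<Longrightarrow> i \<noteq> j \<Longrightarrow> lo \<le> g i + g j \<and> g i + g j \<le> hi"
    and lo: "0 < lo"
  shows "cspectrum A \<subseteq> complex_of_real ` {1 / hi .. 1 / lo}"
proof
  fix \<mu> assume "\<mu> \<in> cspectrum A"
  have y: "\<And>i. i < N \<Longrightarrow> 0 \<le> y i" "(\<Sum>i<N. y i) = 1" and A': "A \<in> carrier_mat (N - 1) (N - 1)"
    using A by (auto simp: inverts_negB_def)
  obtain x where x: "x \<in> carrier_vec (N - 1)" "x \<noteq> 0\<^sub>v (N - 1)" "cmat A *\<^sub>v x = \<mu> \<cdot>\<^sub>v x"
    using \<open>\<mu> \<in> cspectrum A\<close> A' unfolding spectrum_def eigenvalue_def eigenvector_def by auto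
  obtain v where v: "(\<Sum>i<N. v i) = 0" "\<And>l. l < N - 1 \<Longrightarrow> x $ l = mom g N (negB g N y v) l"
    "\<And>l. l < N - 1 \<Longrightarrow> (cmat A *\<^sub>v x) $ l = mom g N v l"
    using inverts_negB_preimage[OF A x(1)] by metis
  have eig: "v i = \<mu> * negB g N y v i" if "i < N" for i
  proof (rule mom_inj[OF inj v(1) _ _ that])
    show "(\<Sum>i<N. \<mu> * negB g N y v i) = 0"
      using sum_negB[OF y(2) v(1)] by (simp flip: sum_distrib_left)
    fix l assume l: "l < N - 1"
    have "mom g N v l = \<mu> * mom g N (negB g N y v) l"
      using l v x by (metis carrier_vecD index_smult_vec(1))
    then show "mom g N v l = mom g N (\<lambda>i. \<mu> * negB g N y v i) l"
      by (simp add: mom_def sum_distrib_left mult_ac)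
  qed
  have v0: "\<exists>i<N. v i \<noteq> 0"
  proof (rule ccontr)
    assume "\<not> (\<exists>i<N. v i \<noteq> 0)"
    then have "x $ l = 0" if "l < N - 1" for l
      using that by (simp add: v(2) mom_def negB_def)
    then show False using x by (auto simp: vec_eq_iff)
  qed
  then have \<mu>: "\<mu> \<noteq> 0" using eig by auto
  have "inverse \<mu> \<in> complex_of_real ` {lo..hi}"
    using y inj f v(1) v0
  proof (rule negB_eigenvalue)
    show "negB g N y v i = inverse \<mu> * v i" if "i < N" for i
      using eig[OF that] \<mu> by (simp add: field_simps)
  qed
  then obtain t where t: "inverse \<mu> = of_real t" "lo \<le> t" "t \<le> hi" by auto
  then have "\<mu> = of_real (1 / t)" by (metis inverse_eq_divide inverse_inverse_eq of_real_inverse)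
  moreover have "1 / t \<in> {1 / hi .. 1 / lo}" using t lo by (auto intro!: divide_left_mono)
  ultimately show "\<mu> \<in> complex_of_real ` {1 / hi .. 1 / lo}" by blast
qed

section \<open>Identification of \<open>A_mat\<close> with the operator in moment
  coordinates\<close>

text \<open>Guarantees that \<open>inv_into\<close> in \<open>y_of\<close> picks a point of the
  closed simplex.\<close>

lemma moment_simplex_subset: "moment_simplex N g \<subseteq> moments N g ` closed_simplex N"
proof
  define p where "p i = vec (N - 1) (\<lambda>l. g i ^ Suc l)" for i
  \<comment> \<open>The hull sums over the set of vertices instead of over indices. The first
    moments tell the vertices apart, so the sums may be reindexed.\<close>
  have inj_p: "inj_on p {..<N}"
  proof (rule inj_onI)
    fix i j assume ij: "i \<in> {..<N}" "j \<in> {..<N}" "p i = p j"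
    then have "p i $ 0 = p j $ 0" by simp
    then have "g i = g j" using N by (simp add: p_def)
    then show "i = j" using ij inj by (auto simp: inj_on_def)
  qed
  fix U assume "U \<in> moment_simplex N g"
  then obtain c where U: "U = vec (N - 1) (\<lambda>l. \<Sum>q\<in>p ` {..<N}. c q * q $ l)"
    and c: "\<forall>q\<in>p ` {..<N}. 0 \<le> c q" "(\<Sum>q\<in>p ` {..<N}. c q) = 1"
    unfolding moment_simplex_def vec_convex_hull_def p_def by blast
  define y where "y = vec N (\<lambda>i. c (p i))"
  have sum1: "(\<Sum>i<N. c (p i)) = 1" using c(2) by (simp add: sum.reindex[OF inj_p])
  have "c (p i) \<le> (\<Sum>i<N. c (p i))" if "i < N" for i
    using that c(1) by (intro member_le_sum) auto
  then have "y \<in> closed_simplex N"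
    using c(1) sum1 by (auto simp: closed_simplex_def y_def)
  moreover have "moments N g y = U"
    by (simp add: moments_def U y_def sum.reindex[OF inj_p] vec_eq_iff del: power_Suc)
      (simp add: p_def mult.commute)
  ultimately show "U \<in> moments N g ` closed_simplex N" by blast
qed

text \<open>Both \<open>inv_into\<close> in \<open>A_op\<close> are evaluated by injectivity at
  known preimages: the moment map takes \<open>(-B) v\<close> to the argument, and \<open>B\<close>
  takes \<open>-v\<close> to \<open>(-B) v\<close>. The outer sign cancels that of
  \<open>-v\<close>.\<close>

lemma A_op_mom_negB:
  assumes f: "\<And>i j. i < N \<Longrightarrow> j < N \<Longrightarrow> i \<noteq> j \<Longrightarrow> f i j = g i + g j"
    and yU: "y_of N g U \<in> closed_simplex N" and v: "(\<Sum>i<N. v i) = 0"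
  shows "A_op N g f U (vec (N - 1) (mom g N (negB g N (($) (y_of N g U)) v))) = vec (N - 1) (mom g N v)"
proof -
  define Y where "Y = y_of N g U"
  define y where "y i = Y $ i" for i
  define B where "B = (\<lambda>v. Bmat N f Y *\<^sub>v v)"
  have y: "\<And>i. i < N \<Longrightarrow> 0 \<le> y i" "(\<Sum>i<N. y i) = 1"
    using yU by (auto simp: closed_simplex_def y_def Y_def)
  have a_pos: "0 < g i + (\<Sum>j<N. g j * y j)" if "i < N" for i
    using diag_bounds[OF y that] \<alpha>_\<beta> by linarith
  have moments: "moments N g w = vec (N - 1) (mom g N (($) w))" for w
    by (auto simp: moments_def mom_def vec_eq_iff)
  have B: "B w = vec N (\<lambda>i. - negB g N y (($) w) i)" if w: "w \<in> zero_sum N" for w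
  proof (rule eq_vecI)
    show "dim_vec (B w) = dim_vec (vec N (\<lambda>i. - negB g N y (($) w) i))"
      by (simp add: B_def Bmat_def)
    fix i assume "i < dim_vec (vec N (\<lambda>i. - negB g N y (($) w) i))"
    then have i: "i < N" by simp
    have w': "w \<in> carrier_vec N" "(\<Sum>j<N. w $ j) = 0" using w by (auto simp: zero_sum_def)
    define m where "m = (\<Sum>j<N. g j * y j)"
    define G where "G = (\<Sum>j<N. g j * w $ j)"
    have Y_diag: "(\<Sum>l\<in>{..<N} - {i}. f i l * y l) = g i + m - 2 * g i * y i"
    proof -
      have "(\<Sum>l\<in>{..<N} - {i}. f i l * y l) = (\<Sum>l\<in>{..<N} - {i}. (g i + g l) * y l)"
        using f i by (intro sum.cong) auto
      also have "\<dots> = (\<Sum>l<N. (g i + g l) * y l) - 2 * g i * y i"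
        using i by (simp add: sum_diff1 algebra_simps)
      also have "(\<Sum>l<N. (g i + g l) * y l) = g i + m"
        using y(2) by (simp add: m_def distrib_right sum.distrib flip: sum_distrib_left)
      finally show ?thesis .
    qed
    have Y_off: "(\<Sum>j\<in>{..<N} - {i}. f i j * w $ j) = G - 2 * g i * w $ i"
    proof -
      have "(\<Sum>j\<in>{..<N} - {i}. f i j * w $ j) = (\<Sum>j\<in>{..<N} - {i}. (g i + g j) * w $ j)"
        using f i by (intro sum.cong) auto
      also have "\<dots> = (\<Sum>j<N. (g i + g j) * w $ j) - 2 * g i * w $ i"
        using i by (simp add: sum_diff1 algebra_simps)
      also have "(\<Sum>j<N. (g i + g j) * w $ j) = G"
        using w'(2) by (simp add: G_def distrib_right sum.distrib flip: sum_distrib_left)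
      finally show ?thesis .
    qed
    have "B w $ i = (\<Sum>j<N. Bmat N f Y $$ (i, j) * w $ j)"
      using i w'(1) by (simp add: B_def Bmat_def scalar_prod_def lessThan_atLeast0)
    also have "\<dots> = Bmat N f Y $$ (i, i) * w $ i + (\<Sum>j\<in>{..<N} - {i}. Bmat N f Y $$ (i, j) * w $ j)"
      using i by (intro sum.remove) auto
    also have "(\<Sum>j\<in>{..<N} - {i}. Bmat N f Y $$ (i, j) * w $ j) = y i * (\<Sum>j\<in>{..<N} - {i}. f i j * w $ j)"
      unfolding sum_distrib_left using i by (intro sum.cong) (auto simp: Bmat_def y_def)
    also have "Bmat N f Y $$ (i, i) = - (g i + m - 2 * g i * y i)"
      using i Y_diag by (simp add: Bmat_def y_def)
    finally have "B w $ i = - negB g N y (($) w) i"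
      unfolding Y_off by (simp add: negB_def m_def G_def algebra_simps)
    then show "B w $ i = vec N (\<lambda>i. - negB g N y (($) w) i) $ i" using i by simp
  qed
  have inj_moments: "inj_on (moments N g) (zero_sum N)"
  proof (rule inj_onI)
    fix u w assume uw: "u \<in> zero_sum N" "w \<in> zero_sum N" "moments N g u = moments N g w"
    have "u $ i = w $ i" if "i < N" for i
    proof (rule mom_inj[OF inj _ _ _ that])
      fix l assume "l < N - 1"
      then show "mom g N (($) u) l = mom g N (($) w) l"
        using arg_cong[OF uw(3)[unfolded moments], of "\<lambda>v. v $ l"] by simp
    qed (use uw in \<open>auto simp: zero_sum_def\<close>)
    then show "u = w" using uw by (auto simp: zero_sum_def vec_eq_iff)
  qed
  have inj_B: "inj_on B (zero_sum N)"
  proof (rule inj_onI)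
    fix u w assume uw: "u \<in> zero_sum N" "w \<in> zero_sum N" "B u = B w"
    \<comment> \<open>\<open>negB_inj\<close> is stated for complex vectors, so the real entries are
      embedded first.\<close>
    have "complex_of_real (u $ i) = of_real (w $ i)" if "i < N" for i
    proof (rule negB_inj[OF y a_pos _ _ _ that])
      fix i assume "i < N"
      then show "negB g N y (\<lambda>i. complex_of_real (u $ i)) i = negB g N y (\<lambda>i. of_real (w $ i)) i"
        using arg_cong[OF uw(3), of "\<lambda>v. v $ i"] uw(1,2) by (simp add: B negB_of_real)
    qed (use uw in \<open>auto simp: zero_sum_def simp flip: of_real_sum\<close>)
    then show "u = w" using uw by (auto simp: zero_sum_def vec_eq_iff)
  qed
  define u where "u = vec N (negB g N y v)"
  define v' where "v' = vec N (\<lambda>i. - v i)"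
  have u: "u \<in> zero_sum N" using sum_negB[OF y(2) v] by (simp add: u_def zero_sum_def)
  have v': "v' \<in> zero_sum N" using v by (simp add: v'_def zero_sum_def sum_negf)
  have "vec (N - 1) (mom g N (negB g N y v)) = moments N g u"
    unfolding moments by (auto simp: vec_eq_iff u_def intro!: mom_cong)
  then have "inv_into (zero_sum N) (moments N g) (vec (N - 1) (mom g N (negB g N y v))) = u"
    using inv_into_f_f[OF inj_moments u] by simp
  moreover have "B v' = u"
    using v' by (auto simp: B u_def v'_def vec_eq_iff negB_def sum_negf)
  then have "inv_into (zero_sum N) B u = v'"
    using inv_into_f_f[OF inj_B v'] by simp
  moreover have "- moments N g v' = vec (N - 1) (mom g N v)"
    by (auto simp: moments v'_def vec_eq_iff mom_def sum_negf simp del: power_Suc)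
  moreover have "($) (y_of N g U) = y" by (simp add: y_def Y_def fun_eq_iff)
  ultimately show ?thesis
    by (simp add: A_op_def B_def Y_def)
qed

text \<open>\<open>A_mat\<close> records \<open>A_op\<close> at unit vectors, whose preimages under
  \<open>L (-B)\<close> are the real vectors \<open>b k\<close>. By injectivity of both maps, a
  complex \<open>v\<close> is the combination of the \<open>b k\<close> with the entries of
  \<open>L (-B) v\<close> as coefficients.\<close>

lemma A_mat_inverts_negB:
  assumes f: "\<And>i j. i < N \<Longrightarrow> j < N \<Longrightarrow> i \<noteq> j \<Longrightarrow> f i j = g i + g j"
    and U: "U \<in> moment_simplex N g"
  shows "inverts_negB g N (($) (y_of N g U)) (A_mat N g f U)"
proof -
  define y where "y = ($) (y_of N g U)"
  have yU: "y_of N g U \<in> closed_simplex N"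
    unfolding y_of_def using U moment_simplex_subset by (intro inv_into_into) auto
  have y: "\<And>i. i < N \<Longrightarrow> 0 \<le> y i" "(\<Sum>i<N. y i) = 1"
    using yU by (auto simp: closed_simplex_def y_def)
  have a_pos: "0 < g i + (\<Sum>j<N. g j * y j)" if "i < N" for i
    using diag_bounds[OF y that] \<alpha>_\<beta> by linarith
  have "\<exists>v :: nat \<Rightarrow> real. (\<Sum>i<N. v i) = 0 \<and>
      (\<forall>l<N - 1. mom g N (negB g N y v) l = unit_vec (N - 1) k $ l)" for k
    by (rule negB_preimage[OF y, of "unit_vec (N - 1) k"]) auto
  then have "\<exists>b :: nat \<Rightarrow> nat \<Rightarrow> real. \<forall>k. (\<Sum>i<N. b k i) = 0 \<and>
      (\<forall>l<N - 1. mom g N (negB g N y (b k)) l = unit_vec (N - 1) k $ l)"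
    by (intro choice allI)
  then obtain b :: "nat \<Rightarrow> nat \<Rightarrow> real" where b: "\<And>k. (\<Sum>i<N. b k i) = 0"
      "\<And>k l. l < N - 1 \<Longrightarrow> mom g N (negB g N y (b k)) l = unit_vec (N - 1) k $ l"
    by blast
  have A: "A_mat N g f U $$ (l, k) = mom g N (b k) l" if "l < N - 1" "k < N - 1" for l k
  proof -
    have "vec (N - 1) (mom g N (negB g N y (b k))) = unit_vec (N - 1) k"
      using b(2) by (auto simp: vec_eq_iff)
    then have "A_op N g f U (unit_vec (N - 1) k) = vec (N - 1) (mom g N (b k))"
      using A_op_mom_negB[OF f yU b(1), of k] unfolding y_def by simp
    then show ?thesis using that by (simp add: A_mat_def)
  qed
  have "(\<Sum>k<N - 1. of_real (A_mat N g f U $$ (l, k)) * mom g N (negB g N y v) k) = mom g N v l"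
    if v: "(\<Sum>i<N. v i) = 0" and l: "l < N - 1" for l and v :: "nat \<Rightarrow> complex"
  proof -
    define c where "c = mom g N (negB g N y v)"
    define v' where "v' i = (\<Sum>k<N - 1. c k * of_real (b k i))" for i
    have "(\<Sum>i<N. v' i) = (\<Sum>k<N - 1. c k * of_real (\<Sum>i<N. b k i))"
      unfolding v'_def by (subst sum.swap) (simp add: sum_distrib_left)
    then have v': "(\<Sum>i<N. v' i) = 0" by (simp add: b(1) del: of_real_sum)
    have "mom g N (negB g N y v') j = c j" if "j < N - 1" for j
    proof -
      have "mom g N (negB g N y v') j = (\<Sum>k<N - 1. c k * of_real (mom g N (negB g N y (b k)) j))"
        unfolding v'_def negB_lincomb mom_lincomb negB_of_real mom_of_real by simp
      also have "\<dots> = (\<Sum>k<N - 1. if j = k then c k else 0)"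
        using that by (intro sum.cong) (auto simp: b(2))
      finally show ?thesis using that by simp
    qed
    then have "negB g N y v' i = negB g N y v i" if "i < N" for i
      using mom_inj[OF inj sum_negB[OF y(2) v'] sum_negB[OF y(2) v] _ that] by (simp add: c_def)
    then have "v' i = v i" if "i < N" for i
      using negB_inj[OF y a_pos v' v _ that] by blast
    then have "mom g N v l = mom g N v' l" by (intro mom_cong) simp
    also have "\<dots> = (\<Sum>k<N - 1. c k * of_real (mom g N (b k) l))"
      unfolding v'_def mom_lincomb mom_of_real by simp
    finally show ?thesis using l by (simp add: A c_def mult.commute)
  qed
  moreover have "A_mat N g f U \<in> carrier_mat (N - 1) (N - 1)" by (simp add: A_mat_def)
  ultimately show ?thesis
    unfolding inverts_negB_def y_def[symmetric] using y by blast
qed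

end

section \<open>Rotation of sectors, and the conclusion\<close>

text \<open>Half of the argument is rotated away: \<open>e * z\<close> lies at angle
  \<open>Arg z / 2\<close> and \<open>e\<close> at the opposite angle. Both are within
  \<open>(pi - \<theta>) / 2\<close> of the positive axis, where the cosine is at least
  \<open>sin (\<theta> / 2)\<close>.\<close>

lemma sector_rotation:
  fixes z :: complex
  assumes \<theta>: "0 < \<theta>" "\<theta> < pi / 2" and z: "z = 0 \<or> \<bar>Arg z\<bar> \<le> pi - \<theta>"
  defines "e \<equiv> cis (- Arg z / 2)"
  shows "sin (\<theta> / 2) * cmod z \<le> Re (e * z)" "sin (\<theta> / 2) \<le> Re e"
proof -
  \<comment> \<open>For \<open>z = 0\<close> this relies on the value
    \<open>Arg 0 = 0\<close>.\<close>
  have "\<bar>Arg z\<bar> \<le> pi - \<theta>" using z \<theta> by (auto simp: Arg_zero)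
  then have "cos ((pi - \<theta>) / 2) \<le> cos (\<bar>Arg z\<bar> / 2)"
    using \<theta> by (intro cos_monotone_0_pi_le) auto
  moreover have "cos ((pi - \<theta>) / 2) = sin (\<theta> / 2)"
    by (simp add: sin_cos_eq diff_divide_distrib)
  moreover have "cos (\<bar>Arg z\<bar> / 2) = cos (Arg z / 2)"
    using cos_abs_real[of "Arg z / 2"] by simp
  ultimately have *: "sin (\<theta> / 2) \<le> cos (Arg z / 2)" by simp
  then show "sin (\<theta> / 2) \<le> Re e" by (simp add: e_def)
  have "e * z = e * rcis (cmod z) (Arg z)" by (simp add: rcis_cmod_Arg)
  also have "\<dots> = of_real (cmod z) * cis (Arg z / 2)"
    by (simp add: e_def rcis_def cis_mult mult.left_commute)
  finally have "Re (e * z) = cmod z * cos (Arg z / 2)" by simp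
  then show "sin (\<theta> / 2) * cmod z \<le> Re (e * z)"
    using * by (simp add: mult.commute mult_left_mono)
qed

theorem proposition7p5:
  fixes N d :: nat
    and g :: "nat \<Rightarrow> real"
    and f :: "nat \<Rightarrow> nat \<Rightarrow> real"
    and fmin fmax :: real
  assumes "2 \<le> N"
    and "1 \<le> d"
    and "0 < g 0"
    and "strict_mono_on {..<N} g"
    and "\<And>i j. i < N \<Longrightarrow> j < N \<Longrightarrow> i \<noteq> j \<Longrightarrow> f i j = g i + g j"
    and "fmin = Min {f i j | i j. i < N \<and> j < N \<and> i \<noteq> j}"
    and "fmax = Max {f i j | i j. i < N \<and> j < N \<and> i \<noteq> j}"
  shows "fmin = g 0 + g 1 \<and> fmax = g (N - 2) + g (N - 1) \<and>
    (\<forall>U \<in> moment_simplex N g.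
       cspectrum (A_mat N g f U) \<subseteq> complex_of_real ` {1 / fmax .. 1 / fmin}) \<and>
    uniformly_normally_elliptic d (N - 1) (moment_simplex N g) (A_mat N g f) \<and>
    (\<forall>U \<in> moment_simplex N g. invertible_mat (A_mat N g f U)) \<and>
    bdd_above ((\<lambda>U. opnorm (A_mat N g f U) + opnorm (minv (A_mat N g f U)))
      ` moment_simplex N g)"
proof -
  interpret positive_nodes N g using assms(1,3,4) by unfold_locales
  let ?T = "moment_simplex N g" and ?A = "A_mat N g f"
  have A: "inverts_negB g N (($) (y_of N g U)) (?A U)" if "U \<in> ?T" for U
    using assms(5) that by (rule A_mat_inverts_negB)
  have dim: "?A U \<in> carrier_mat (N - 1) (N - 1)" for U by (simp add: A_mat_def)
  let ?F = "{f i j | i j. i < N \<and> j < N \<and> i \<noteq> j}"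
  have fin: "finite ?F"
    by (rule finite_subset[of _ "case_prod f ` ({..<N} \<times> {..<N})"]) auto
  have le: "g i \<le> g j" if "i \<le> j" "j < N" for i j
    using strict_mono_on_leD[OF mono, of i j] that by auto
  \<comment> \<open>For \<open>i < j < N\<close> one has \<open>i \<le> N - 2\<close> and
    \<open>1 \<le> j\<close>, so monotonicity bounds the sums termwise.\<close>
  have ordered: "g 0 + g 1 \<le> g i + g j" "g i + g j \<le> g (N - 2) + g (N - 1)" if "i < j" "j < N" for i j
    by (intro add_mono le; use that in arith)+
  have lower: "g 0 + g 1 \<le> g i + g j" and upper: "g i + g j \<le> g (N - 2) + g (N - 1)"
    if "i < N" "j < N" "i \<noteq> j" for i j
    using that ordered[of i j] ordered[of j i] by (cases "i < j"; simp add: add.commute)+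
  have "g 0 + g 1 \<in> ?F"
    using N assms(5)[of 0 1] by (intro CollectI exI[of _ 0] exI[of _ 1]) simp
  then have fmin: "fmin = g 0 + g 1"
    unfolding assms(6) using assms(5) lower fin by (intro Min_eqI) auto
  have "g (N - 2) + g (N - 1) \<in> ?F"
    using N assms(5)[of "N - 2" "N - 1"] by (intro CollectI exI[of _ "N - 2"] exI[of _ "N - 1"]) simp
  then have fmax: "fmax = g (N - 2) + g (N - 1)"
    unfolding assms(7) using assms(5) upper fin by (intro Max_eqI) auto
  have fmin_pos: "0 < fmin" using g_pos le[of 0 1] N by (simp add: fmin)
  have fmax_pos: "0 < fmax" using ordered(2)[of 0 1] fmin_pos N by (simp add: fmin fmax)
  have spec: "cspectrum (?A U) \<subseteq> complex_of_real ` {1 / fmax .. 1 / fmin}" if "U \<in> ?T" for U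
    using A[OF that] _ fmin_pos by (rule inverts_negB_spectrum) (use lower upper in \<open>simp add: fmin fmax\<close>)
  have "\<exists>C. \<forall>U\<in>?T. \<forall>\<xi>\<in>(carrier_vec d :: real vec set). \<forall>z::complex.
          (z = 0 \<or> \<bar>Arg z\<bar> \<le> pi - \<theta>) \<and> (z \<noteq> 0 \<or> \<xi> \<noteq> 0\<^sub>v d) \<longrightarrow>
          (let M = z \<cdot>\<^sub>m 1\<^sub>m (N - 1) + cmat ((enorm \<xi>)\<^sup>2 \<cdot>\<^sub>m ?A U)
           in invertible_mat M \<and> opnorm (minv M) \<le> C / (cmod z + (enorm \<xi>)\<^sup>2))"
    if \<theta>: "0 < \<theta>" "\<theta> < pi / 2" for \<theta>
  proof -
    have sin_pos: "0 < sin (\<theta> / 2)" using \<theta> by (intro sin_gt_zero) auto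
    obtain C where C: "0 \<le> C" "\<And>y A x z e r. inverts_negB g N y A \<Longrightarrow> x \<in> carrier_vec (N - 1) \<Longrightarrow> cmod e = 1 \<Longrightarrow>
       sin (\<theta> / 2) * cmod z \<le> Re (e * z) \<Longrightarrow> sin (\<theta> / 2) \<le> Re e \<Longrightarrow> 0 \<le> r \<Longrightarrow> 0 < cmod z + r \<Longrightarrow>
       enorm x \<le> C / (cmod z + r) * enorm ((z \<cdot>\<^sub>m 1\<^sub>m (N - 1) + cmat (r \<cdot>\<^sub>m A)) *\<^sub>v x)"
      by (fact inverts_negB_resolvent[OF sin_pos])
    have "let M = z \<cdot>\<^sub>m 1\<^sub>m (N - 1) + cmat ((enorm \<xi>)\<^sup>2 \<cdot>\<^sub>m ?A U)
       in invertible_mat M \<and> opnorm (minv M) \<le> C / (cmod z + (enorm \<xi>)\<^sup>2)"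
      if U: "U \<in> ?T" and \<xi>: "\<xi> \<in> carrier_vec d" and z: "z = 0 \<or> \<bar>Arg z\<bar> \<le> pi - \<theta>"
        and nz: "z \<noteq> 0 \<or> \<xi> \<noteq> 0\<^sub>v d" for U \<xi> z
    proof -
      have pos: "0 < cmod z + (enorm \<xi>)\<^sup>2"
        using nz \<xi> enorm_zero_iff[of \<xi>] by (auto intro: add_pos_nonneg add_nonneg_pos)
      define M where "M = z \<cdot>\<^sub>m 1\<^sub>m (N - 1) + cmat ((enorm \<xi>)\<^sup>2 \<cdot>\<^sub>m ?A U)"
      have "M \<in> carrier_mat (N - 1) (N - 1)" using dim[of U] by (simp add: M_def)
      moreover have "0 \<le> C / (cmod z + (enorm \<xi>)\<^sup>2)" using C(1) pos by simp
      moreover have "enorm x \<le> C / (cmod z + (enorm \<xi>)\<^sup>2) * enorm (M *\<^sub>v x)"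
        if "x \<in> carrier_vec (N - 1)" for x
        unfolding M_def
        by (rule C(2)[OF A[OF U] that _ sector_rotation[OF \<theta> z] _ pos]) auto
      ultimately show ?thesis unfolding Let_def M_def[symmetric]
        using bounded_below_invertible by blast
    qed
    then show ?thesis by blast
  qed
  \<comment> \<open>At \<open>enorm \<xi> = 1\<close> the symbol is \<open>A U\<close> itself, so
    the lower end of the spectral interval serves as the constant.\<close>
  moreover have "\<exists>c>0. \<forall>U\<in>?T. \<forall>\<xi>\<in>(carrier_vec d :: real vec set). enorm \<xi> = 1 \<longrightarrow>
        cspectrum ((enorm \<xi>)\<^sup>2 \<cdot>\<^sub>m ?A U) \<subseteq> {\<mu>. c \<le> Re \<mu>}"
  proof (intro exI[of _ "1 / fmax"] conjI ballI impI)
    show "0 < 1 / fmax" using fmax_pos by simp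
    fix U and \<xi> :: "real vec" assume U: "U \<in> ?T" and "enorm \<xi> = 1"
    then have "(enorm \<xi>)\<^sup>2 \<cdot>\<^sub>m ?A U = ?A U" by auto
    then show "cspectrum ((enorm \<xi>)\<^sup>2 \<cdot>\<^sub>m ?A U) \<subseteq> {\<mu>. 1 / fmax \<le> Re \<mu>}"
      using spec[OF U] by auto
  qed
  ultimately have elliptic: "uniformly_normally_elliptic d (N - 1) ?T ?A"
    unfolding uniformly_normally_elliptic_def by blast
  \<comment> \<open>At \<open>z = 0\<close>, \<open>r = 1\<close> the resolvent bound becomes the
    bound for the inverse of \<open>A U\<close>; \<open>e = s = 1\<close> meets the sector
    condition.\<close>
  have one_pos: "0 < (1::real)" by simp
  obtain C where C: "0 \<le> C" "\<And>y A x z e r. inverts_negB g N y A \<Longrightarrow> x \<in> carrier_vec (N - 1) \<Longrightarrow> cmod e = 1 \<Longrightarrow>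
       1 * cmod z \<le> Re (e * z) \<Longrightarrow> 1 \<le> Re e \<Longrightarrow> 0 \<le> r \<Longrightarrow> 0 < cmod z + r \<Longrightarrow>
       enorm x \<le> C / (cmod z + r) * enorm ((z \<cdot>\<^sub>m 1\<^sub>m (N - 1) + cmat (r \<cdot>\<^sub>m A)) *\<^sub>v x)"
    by (fact inverts_negB_resolvent[OF one_pos])
  obtain D where D: "0 \<le> D" "\<And>y A x. inverts_negB g N y A \<Longrightarrow> x \<in> carrier_vec (N - 1) \<Longrightarrow>
       enorm (cmat A *\<^sub>v x) \<le> D * enorm x"
    by (fact inverts_negB_bounded)
  have below: "enorm x \<le> C * enorm (?A U *\<^sub>v x)" if "U \<in> ?T" "x \<in> carrier_vec (N - 1)" for U x
  proof -
    have "0 \<cdot>\<^sub>m 1\<^sub>m (N - 1) + cmat (1 \<cdot>\<^sub>m ?A U) = cmat (?A U)"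
      using dim[of U] by (intro eq_matI) auto
    \<comment> \<open>Complex estimates restrict to real vectors, because the embedding commutes
      with the matrix and preserves the norm.\<close>
    then have "enorm (map_vec complex_of_real x) \<le> C * enorm (cmat (?A U) *\<^sub>v map_vec of_real x)"
      using C(2)[OF A[OF that(1)], of "map_vec of_real x" 1 0 1] that(2) by simp
    then show ?thesis by (simp add: cmat_mult_vec[OF dim that(2)] enorm_of_real)
  qed
  have above: "enorm (?A U *\<^sub>v x) \<le> D * enorm x" if "U \<in> ?T" "x \<in> carrier_vec (N - 1)" for U x
    using D(2)[OF A[OF that(1)], of "map_vec of_real x"] that(2)
    by (simp add: cmat_mult_vec[OF dim that(2)] enorm_of_real)
  have inv: "invertible_mat (?A U)" "opnorm (minv (?A U)) \<le> C" if "U \<in> ?T" for U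
    using bounded_below_invertible[OF dim C(1) below[OF that]] by auto
  have "opnorm (?A U) \<le> D" if "U \<in> ?T" for U
    by (rule opnorm_le[OF D(1)]) (use above[OF that] dim[of U] in auto)
  then have "bdd_above ((\<lambda>U. opnorm (?A U) + opnorm (minv (?A U))) ` ?T)"
    using inv(2) by (intro bdd_aboveI2[of _ _ "D + C"] add_mono)
  then show ?thesis using fmin fmax spec elliptic inv(1) by blast
qed

end
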